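(* Let $\mathbf{k}$ be a commutative ring and let $B$ be a commutative $\mathbf{k}$-bialgebra. Let $L$ denote the set of all id-unipotent elements of $B$. Let $g_1,g_2,\ldots,g_n$ be $n$ grouplike elements of $B$. Assume that: (1) for any $1\le i<j\le n$, the element $g_i-g_j$ of $B$ is regular; (2) for any $1\le i\le n$, the element $g_i$ of $B$ is regular. Then $g_1,g_2,\ldots,g_n$ are $L$-linearly independent.
   Context: All algebras, coalgebras, linear maps and tensor products are over $\mathbf{k}$. A $\mathbf{k}$-bialgebra $B$ is a $\mathbf{k}$-module that is both an (associative, unital) $\mathbf{k}$-algebra, with multiplication $\mu:B\otimes B\to B$ and unit map $\eta:\mathbf{k}\to B$, and a (coassociative, counital) $\mathbf{k}$-coalgebra, with comultiplication $\Delta$ and counit $\epsilon$, such that $\Delta$ and $\epsilon$ are $\mathbf{k}$-algebra homomorphisms. (No antipode is assumed.) Convolution: for $f,g\in\operatorname{Hom}_{\mathbf{k}}(B,B)$, set $f\circledast g=\mu\circ(f\otimes g)\circ\Delta$. This makes $\operatorname{Hom}_{\mathbf{k}}(B,B)$ a $\mathbf{k}$-algebra with unity $\eta\epsilon=\eta\circ\epsilon$; $f^{\circledast n}$ is the $n$-th power of $f$ with respect to $\circledast$ (so $f^{\circledast 0}=\eta\epsilon$). Grouplike: $g\in B$ is grouplike if $\Delta(g)=g\otimes g$ and $\epsilon(g)=1$. Id-unipotent: $b\in B$ is id-unipotent if there exists $m\in\mathbb{Z}$ such that every nonnegative integer $n>m$ satisfies $(\eta\epsilon-\operatorname{id}_B)^{\circledast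 n}(b)=0$. Regular: an element $a$ of a commutative ring $A$ is regular if every $b\in A$ with $ab=0$ satisfies $b=0$. $S$-linear independence: for a subset $S$ of a commutative $\mathbf{k}$-algebra $A$, elements $g_1,\ldots,g_n\in A$ are $S$-linearly independent if every $n$-tuple $(s_1,\ldots,s_n)\in S^n$ with $\sum_{i=1}^n s_i g_i=0$ satisfies $s_i=0$ for all $i$. *)

theory Defs
  imports "HOL-Algebra.Algebra"
begin

text \<open>
  All structures live on carrier sets, and none of the locales used below excludes the zero ring.
\<close>

section \<open>Tensor products of modules over a commutative ring\<close>

text \<open>
  \<open>M \<otimes> N\<close> is the free abelian group on \<open>carrier M \<times> carrier N\<close> modulo the relations making the
  class of \<open>(x, y)\<close> biadditive and balanced over \<open>R\<close>; its elements are cosets of formal sums.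
\<close>

definition tensor_relators ::
  "('k, 'r) ring_scheme \<Rightarrow> ('k, 'a, 'm) module_scheme \<Rightarrow> ('k, 'b, 'n) module_scheme
    \<Rightarrow> (('a \<times> 'b) \<Rightarrow>\<^sub>0 int) set"
  where "tensor_relators R M N =
    {frag_of (x \<oplus>\<^bsub>M\<^esub> x', y) - frag_of (x, y) - frag_of (x', y) | x x' y.
       x \<in> carrier M \<and> x' \<in> carrier M \<and> y \<in> carrier N} \<union>
    {frag_of (x, y \<oplus>\<^bsub>N\<^esub> y') - frag_of (x, y) - frag_of (x, y') | x y y'.
       x \<in> carrier M \<and> y \<in> carrier N \<and> y' \<in> carrier N} \<union>
    {frag_of (r \<odot>\<^bsub>M\<^esub> x, y) - frag_of (x, r \<odot>\<^bsub>N\<^esub> y) | r x y.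
       r \<in> carrier R \<and> x \<in> carrier M \<and> y \<in> carrier N}"

abbreviation tensor_free ::
  "('k, 'a, 'm) module_scheme \<Rightarrow> ('k, 'b, 'n) module_scheme \<Rightarrow> (('a \<times> 'b) \<Rightarrow>\<^sub>0 int) monoid"
  where "tensor_free M N \<equiv> free_Abelian_group (carrier M \<times> carrier N)"

definition tensor_kernel ::
  "('k, 'r) ring_scheme \<Rightarrow> ('k, 'a, 'm) module_scheme \<Rightarrow> ('k, 'b, 'n) module_scheme
    \<Rightarrow> (('a \<times> 'b) \<Rightarrow>\<^sub>0 int) set"
  where "tensor_kernel R M N = generate (tensor_free M N) (tensor_relators R M N)"

definition pure_tensor ::
  "('k, 'r) ring_scheme \<Rightarrow> ('k, 'a, 'm) module_scheme \<Rightarrow> ('k, 'b, 'n) module_scheme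
    \<Rightarrow> 'a \<Rightarrow> 'b \<Rightarrow> (('a \<times> 'b) \<Rightarrow>\<^sub>0 int) set"
  where "pure_tensor R M N x y = tensor_kernel R M N #>\<^bsub>tensor_free M N\<^esub> frag_of (x, y)"

text \<open>
  The additive map out of a tensor product that a balanced biadditive map \<open>\<phi>\<close> into the abelian
  group \<open>P\<close> induces. Such a \<open>\<phi>\<close> makes the sum below take the same value on all
  representatives \<open>c\<close> of the coset \<open>t\<close>.
\<close>

definition tensor_lift ::
  "('c, 'p) ring_scheme \<Rightarrow> ('a \<Rightarrow> 'b \<Rightarrow> 'c) \<Rightarrow> (('a \<times> 'b) \<Rightarrow>\<^sub>0 int) set \<Rightarrow> 'c"
  where "tensor_lift P \<phi> t = the_elem
    ((\<lambda>c. \<Oplus>\<^bsub>P\<^esub>p\<in>Poly_Mapping.keys c. add_pow P (Poly_Mapping.lookup c p) (\<phi> (fst p) (snd p))) ` t)"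

text \<open>The additive group of the tensor product; its multiplicative fields are placeholders.\<close>

definition tensor_group ::
  "('k, 'r) ring_scheme \<Rightarrow> ('k, 'a, 'm) module_scheme \<Rightarrow> ('k, 'b, 'n) module_scheme
    \<Rightarrow> (('a \<times> 'b) \<Rightarrow>\<^sub>0 int) set ring"
  where "tensor_group R M N =
    (let Q = tensor_free M N Mod tensor_kernel R M N in
      \<lparr>carrier = carrier Q, monoid.mult = (\<lambda>_ _. \<one>\<^bsub>Q\<^esub>), one = \<one>\<^bsub>Q\<^esub>,
       ring.zero = \<one>\<^bsub>Q\<^esub>, ring.add = monoid.mult Q\<rparr>)"

text \<open>
  \<open>r (x \<otimes> y) = (r x) \<otimes> y\<close> and \<open>(x \<otimes> y) (x' \<otimes> y') = x x' \<otimes> y y'\<close>. The multiplicative fields are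
  meaningful when \<open>M\<close> and \<open>N\<close> are algebras; for mere modules they are to be ignored.
\<close>

definition tensor ::
  "('k, 'r) ring_scheme \<Rightarrow> ('k, 'a, 'm) module_scheme \<Rightarrow> ('k, 'b, 'n) module_scheme
    \<Rightarrow> ('k, (('a \<times> 'b) \<Rightarrow>\<^sub>0 int) set) module"
  where "tensor R M N =
    (let T = tensor_group R M N; pt = pure_tensor R M N in
      \<lparr>carrier = carrier T,
       monoid.mult = (\<lambda>s t. tensor_lift T (\<lambda>x y.
          tensor_lift T (\<lambda>x' y'. pt (x \<otimes>\<^bsub>M\<^esub> x') (y \<otimes>\<^bsub>N\<^esub> y')) t) s),
       one = pt \<one>\<^bsub>M\<^esub> \<one>\<^bsub>N\<^esub>,
       ring.zero = ring.zero T,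
       ring.add = ring.add T,
       smult = (\<lambda>r. tensor_lift T (\<lambda>x y. pt (r \<odot>\<^bsub>M\<^esub> x) y))\<rparr>)"

definition linear_maps ::
  "('k, 'r) ring_scheme \<Rightarrow> ('k, 'a, 'm) module_scheme \<Rightarrow> ('k, 'b, 'n) module_scheme \<Rightarrow> ('a \<Rightarrow> 'b) set"
  where "linear_maps R M N =
    {f \<in> carrier M \<rightarrow> carrier N.
      (\<forall>x \<in> carrier M. \<forall>y \<in> carrier M. f (x \<oplus>\<^bsub>M\<^esub> y) = f x \<oplus>\<^bsub>N\<^esub> f y) \<and>
      (\<forall>r \<in> carrier R. \<forall>x \<in> carrier M. f (r \<odot>\<^bsub>M\<^esub> x) = r \<odot>\<^bsub>N\<^esub> f x)}"

text \<open>\<open>f \<otimes> g : M \<otimes> N \<rightarrow> M' \<otimes> N'\<close>, where \<open>f : M \<rightarrow> M'\<close> and \<open>g : N \<rightarrow> N'\<close>; only the target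
  modules occur in the definition.\<close>

definition tensor_map ::
  "('k, 'r) ring_scheme \<Rightarrow> ('k, 'c, 'm) module_scheme \<Rightarrow> ('k, 'd, 'n) module_scheme
    \<Rightarrow> ('a \<Rightarrow> 'c) \<Rightarrow> ('b \<Rightarrow> 'd)
    \<Rightarrow> (('a \<times> 'b) \<Rightarrow>\<^sub>0 int) set \<Rightarrow> (('c \<times> 'd) \<Rightarrow>\<^sub>0 int) set"
  where "tensor_map R M' N' f g =
    tensor_lift (tensor R M' N') (\<lambda>x y. pure_tensor R M' N' (f x) (g y))"

text \<open>\<open>(L \<otimes> M) \<otimes> N \<rightarrow> L \<otimes> (M \<otimes> N)\<close>, sending \<open>(x \<otimes> y) \<otimes> z\<close> to \<open>x \<otimes> (y \<otimes> z)\<close>.\<close>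

definition tensor_assoc ::
  "('k, 'r) ring_scheme \<Rightarrow> ('k, 'a, 'l) module_scheme \<Rightarrow> ('k, 'b, 'm) module_scheme
    \<Rightarrow> ('k, 'c, 'n) module_scheme
    \<Rightarrow> (((('a \<times> 'b) \<Rightarrow>\<^sub>0 int) set \<times> 'c) \<Rightarrow>\<^sub>0 int) set
    \<Rightarrow> (('a \<times> (('b \<times> 'c) \<Rightarrow>\<^sub>0 int) set) \<Rightarrow>\<^sub>0 int) set"
  where "tensor_assoc R L M N =
    (let T = tensor R L (tensor R M N) in
      tensor_lift T (\<lambda>s z. tensor_lift T
        (\<lambda>x y. pure_tensor R L (tensor R M N) x (pure_tensor R M N y z)) s))"

definition self_module :: "('k, 'r) ring_scheme \<Rightarrow> ('k, 'k) module"
  where "self_module R =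
    \<lparr>carrier = carrier R, monoid.mult = monoid.mult R, one = \<one>\<^bsub>R\<^esub>,
     ring.zero = \<zero>\<^bsub>R\<^esub>, ring.add = ring.add R, smult = monoid.mult R\<rparr>"


section \<open>Coalgebras and bialgebras\<close>

locale coalgebra = module R C
  for R :: "('k, 'r) ring_scheme" (structure)
    and C :: "('k, 'c, 'm) module_scheme" (structure) +
  fixes \<Delta> :: "'c \<Rightarrow> (('c \<times> 'c) \<Rightarrow>\<^sub>0 int) set"
    and \<epsilon> :: "'c \<Rightarrow> 'k"
  assumes comult_linear: "\<Delta> \<in> linear_maps R C (tensor R C C)"
    and counit_linear: "\<epsilon> \<in> linear_maps R C (self_module R)"
    and coassoc: "c \<in> carrier C \<Longrightarrow>
      tensor_assoc R C C C (tensor_map R (tensor R C C) C \<Delta> (\<lambda>x. x) (\<Delta> c)) =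
      tensor_map R C (tensor R C C) (\<lambda>x. x) \<Delta> (\<Delta> c)"
    and counit_left: "c \<in> carrier C \<Longrightarrow>
      tensor_map R (self_module R) C \<epsilon> (\<lambda>x. x) (\<Delta> c) = pure_tensor R (self_module R) C \<one>\<^bsub>R\<^esub> c"
    and counit_right: "c \<in> carrier C \<Longrightarrow>
      tensor_map R C (self_module R) (\<lambda>x. x) \<epsilon> (\<Delta> c) = pure_tensor R C (self_module R) c \<one>\<^bsub>R\<^esub>"

text \<open>The locale \<^locale>\<open>algebra\<close> of the library already comprises commutativity of \<open>B\<close>.\<close>

locale commutative_bialgebra = algebra R B + coalgebra R B \<Delta> \<epsilon>
  for R :: "('k, 'r) ring_scheme" (structure)
    and B :: "('k, 'b, 'm) module_scheme" (structure)
    and \<Delta> :: "'b \<Rightarrow> (('b \<times> 'b) \<Rightarrow>\<^sub>0 int) set"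
    and \<epsilon> :: "'b \<Rightarrow> 'k" +
  assumes comult_hom: "\<Delta> \<in> ring_hom B (tensor R B B)"
    and counit_hom: "\<epsilon> \<in> ring_hom B R"

text \<open>Maps are functions on the whole type; only their values on the carriers matter.\<close>

definition unit_map :: "('k, 'b, 'm) module_scheme \<Rightarrow> 'k \<Rightarrow> 'b"
  where "unit_map B r = r \<odot>\<^bsub>B\<^esub> \<one>\<^bsub>B\<^esub>"

definition mult_map :: "('k, 'b, 'm) module_scheme \<Rightarrow> (('b \<times> 'b) \<Rightarrow>\<^sub>0 int) set \<Rightarrow> 'b"
  where "mult_map B = tensor_lift B (\<lambda>x y. x \<otimes>\<^bsub>B\<^esub> y)"

definition convolution ::
  "('k, 'r) ring_scheme \<Rightarrow> ('k, 'b, 'm) module_scheme \<Rightarrow> ('b \<Rightarrow> (('b \<times> 'b) \<Rightarrow>\<^sub>0 int) set)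
    \<Rightarrow> ('b \<Rightarrow> 'b) \<Rightarrow> ('b \<Rightarrow> 'b) \<Rightarrow> 'b \<Rightarrow> 'b"
  where "convolution R B \<Delta> f g = mult_map B \<circ> tensor_map R B B f g \<circ> \<Delta>"

primrec conv_power ::
  "('k, 'r) ring_scheme \<Rightarrow> ('k, 'b, 'm) module_scheme \<Rightarrow> ('b \<Rightarrow> (('b \<times> 'b) \<Rightarrow>\<^sub>0 int) set)
    \<Rightarrow> ('b \<Rightarrow> 'k) \<Rightarrow> ('b \<Rightarrow> 'b) \<Rightarrow> nat \<Rightarrow> 'b \<Rightarrow> 'b"
  where
    "conv_power R B \<Delta> \<epsilon> f 0 = unit_map B \<circ> \<epsilon>"
  | "conv_power R B \<Delta> \<epsilon> f (Suc n) = convolution R B \<Delta> f (conv_power R B \<Delta> \<epsilon> f n)"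

definition grouplike ::
  "('k, 'r) ring_scheme \<Rightarrow> ('k, 'b, 'm) module_scheme \<Rightarrow> ('b \<Rightarrow> (('b \<times> 'b) \<Rightarrow>\<^sub>0 int) set)
    \<Rightarrow> ('b \<Rightarrow> 'k) \<Rightarrow> 'b \<Rightarrow> bool"
  where "grouplike R B \<Delta> \<epsilon> g \<longleftrightarrow>
    g \<in> carrier B \<and> \<Delta> g = pure_tensor R B B g g \<and> \<epsilon> g = \<one>\<^bsub>R\<^esub>"

definition id_unipotent ::
  "('k, 'r) ring_scheme \<Rightarrow> ('k, 'b, 'm) module_scheme \<Rightarrow> ('b \<Rightarrow> (('b \<times> 'b) \<Rightarrow>\<^sub>0 int) set)
    \<Rightarrow> ('b \<Rightarrow> 'k) \<Rightarrow> 'b \<Rightarrow> bool"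
  where "id_unipotent R B \<Delta> \<epsilon> b \<longleftrightarrow>
    b \<in> carrier B \<and>
    (\<exists>m::int. \<forall>n::nat. int n > m \<longrightarrow>
      conv_power R B \<Delta> \<epsilon> (\<lambda>x. unit_map B (\<epsilon> x) \<ominus>\<^bsub>B\<^esub> x) n b = \<zero>\<^bsub>B\<^esub>)"

definition regular_element :: "('a, 'm) ring_scheme \<Rightarrow> 'a \<Rightarrow> bool"
  where "regular_element A a \<longleftrightarrow>
    a \<in> carrier A \<and> (\<forall>b \<in> carrier A. a \<otimes>\<^bsub>A\<^esub> b = \<zero>\<^bsub>A\<^esub> \<longrightarrow> b = \<zero>\<^bsub>A\<^esub>)"

text \<open>\<open>S\<close>-linear independence of \<open>g 1, \<dots>, g n\<close>; the set \<open>S\<close> need not be a subring.\<close>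

definition lin_independent_over ::
  "('a, 'm) ring_scheme \<Rightarrow> 'a set \<Rightarrow> nat \<Rightarrow> (nat \<Rightarrow> 'a) \<Rightarrow> bool"
  where "lin_independent_over A S n g \<longleftrightarrow>
    (\<forall>s \<in> {1..n} \<rightarrow> S. (\<Oplus>\<^bsub>A\<^esub>i\<in>{1..n}. s i \<otimes>\<^bsub>A\<^esub> g i) = \<zero>\<^bsub>A\<^esub> \<longrightarrow>
      (\<forall>i \<in> {1..n}. s i = \<zero>\<^bsub>A\<^esub>))"

end

theory Submission
  imports Defs
begin

text \<open>
  Write \<open>id\<^sup>k\<close> for the \<open>k\<close>-th convolution power of the identity of \<open>B\<close>. The proof applies these maps
  to a relation \<open>\<Sum> s\<^sub>i g\<^sub>i = 0\<close> for all \<open>k\<close> at once. As \<open>B\<close> is commutative, each \<open>id\<^sup>k\<close> is a ring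
  homomorphism (\<open>id_power_ring_hom\<close>), and it sends a grouplike \<open>g\<close> to \<open>g ^ k\<close>
  (\<open>id_power_grouplike\<close>). The relation becomes \<open>\<Sum> p\<^sub>i(k) g\<^sub>i ^ k = 0\<close> for every natural number \<open>k\<close>,
  where \<open>p\<^sub>i(k) = id\<^sup>k(s\<^sub>i)\<close>.

  Id-unipotence of \<open>b\<close> says that \<open>k \<mapsto> id\<^sup>k(b)\<close> is polynomial: with \<open>\<delta> = \<eta>\<epsilon> - id\<close>, the binomial
  formula \<open>id\<^sup>k = (\<eta>\<epsilon> - \<delta>)\<^sup>k = \<Sum>\<^sub>j (-1) ^ j (k choose j) \<delta>\<^sup>j\<close> holds, and only finitely many
  \<open>\<delta>\<^sup>j(b)\<close> are nonzero. All this is phrased with iterated backward differences instead of binomial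
  coefficients: the formula says that \<open>id\<^sup>k(b)\<close> is the \<open>k\<close>-th difference at \<open>0\<close> of \<open>j \<mapsto> \<delta>\<^sup>j(b)\<close>
  (\<open>id_power_eq_bdiff\<close>), and being polynomial means being killed by an iterated difference
  (\<open>id_unipotent_bdiff_nilpotent\<close>).

  So the theorem reduces to the independence of exponential polynomials
  (\<open>exponential_polynomials_independent\<close>): if \<open>\<Sum> p\<^sub>i(k) g\<^sub>i ^ k = 0\<close> for all \<open>k\<close>, then all \<open>p\<^sub>i\<close>
  vanish. The operator ``shift minus \<open>g\<^sub>a\<close>'' lowers the degree of \<open>p\<^sub>a\<close>, while on the other terms it
  acts injectively because \<open>g\<^sub>i - g\<^sub>a\<close> is regular; this allows an induction on the degree of \<open>p\<^sub>a\<close>.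
  Finally \<open>s\<^sub>i = p\<^sub>i(1) = 0\<close>.

  The facts about convolution come from the universal property of the tensor product: a balanced
  biadditive map extends uniquely to an additive map, so identities between additive maps need
  to be checked on pure tensors only.
\<close>

section \<open>Exponential polynomials over a commutative ring\<close>

text \<open>
  The difference is taken backwards, \<open>a k - a (k + 1)\<close>, so that forming the sequence of all iterated
  differences at \<open>0\<close> is an involution, without alternating signs.
\<close>

definition bdiff :: "('a, 'm) ring_scheme \<Rightarrow> (nat \<Rightarrow> 'a) \<Rightarrow> nat \<Rightarrow> 'a"
  where "bdiff A a = (\<lambda>k. a k \<ominus>\<^bsub>A\<^esub> a (Suc k))"

context cring
begin

lemma bdiff_pow_closed:
  assumes "\<And>k. a k \<in> carrier R"
  shows "(bdiff R ^^ d) a k \<in> carrier R"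
  using assms by (induction d arbitrary: k) (auto simp: bdiff_def)

lemma bdiff_pow_linear:
  assumes "\<And>k. a k \<in> carrier R" "\<And>k. b k \<in> carrier R" "x \<in> carrier R" "y \<in> carrier R"
  shows "(bdiff R ^^ d) (\<lambda>k. x \<otimes> a k \<ominus> y \<otimes> b k) k
    = x \<otimes> (bdiff R ^^ d) a k \<ominus> y \<otimes> (bdiff R ^^ d) b k"
proof (induction d arbitrary: k)
  case (Suc d)
  note [simp] = bdiff_pow_closed[of a, OF assms(1)] bdiff_pow_closed[of b, OF assms(2)] assms(3,4)
  have "(bdiff R ^^ Suc d) (\<lambda>k. x \<otimes> a k \<ominus> y \<otimes> b k) k =
     (x \<otimes> (bdiff R ^^ d) a k \<ominus> y \<otimes> (bdiff R ^^ d) b k)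
     \<ominus> (x \<otimes> (bdiff R ^^ d) a (Suc k) \<ominus> y \<otimes> (bdiff R ^^ d) b (Suc k))"
    by (simp add: bdiff_def[of R "(bdiff R ^^ d) _"] Suc.IH)
  also have "\<dots> = x \<otimes> ((bdiff R ^^ d) a k \<ominus> (bdiff R ^^ d) a (Suc k))
     \<ominus> y \<otimes> ((bdiff R ^^ d) b k \<ominus> (bdiff R ^^ d) b (Suc k))"
    using bdiff_pow_closed[of a d, OF assms(1)] bdiff_pow_closed[of b d, OF assms(2)] assms(3,4)
    by algebra
  finally show ?case by (simp add: bdiff_def[of R "(bdiff R ^^ d) _"])
qed (use assms in auto)

text \<open>
  If \<open>a k\<close> is the \<open>k\<close>-th difference of \<open>c\<close> at \<open>0\<close>, then \<open>a k - a (k + 1)\<close> is the \<open>k\<close>-th difference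
  of \<open>c\<close> at \<open>1\<close>: taking a difference of \<open>a\<close> amounts to shifting \<open>c\<close>. Consequently \<open>a\<close> is
  polynomial as soon as \<open>c\<close> has finite support.
\<close>

lemma bdiff_duality:
  assumes "\<And>j. c j \<in> carrier R"
  shows "(bdiff R ^^ j) (\<lambda>k. (bdiff R ^^ k) c 0) k = (bdiff R ^^ k) c j"
proof (induction j arbitrary: k)
  case (Suc j)
  note [simp] = bdiff_pow_closed[of c, OF assms]
  have "(bdiff R ^^ Suc j) (\<lambda>k. (bdiff R ^^ k) c 0) k
      = (bdiff R ^^ k) c j \<ominus> (bdiff R ^^ Suc k) c j"
    by (simp only: funpow.simps comp_def bdiff_def[of R "(bdiff R ^^ j) _"] Suc.IH)
  also have "\<dots> = (bdiff R ^^ k) c j \<ominus> ((bdiff R ^^ k) c j \<ominus> (bdiff R ^^ k) c (Suc j))"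
    by (simp add: bdiff_def)
  also have "\<dots> = (bdiff R ^^ k) c (Suc j)"
  proof -
    have "x \<ominus> (x \<ominus> y) = y" if "x \<in> carrier R" "y \<in> carrier R" for x y
      using that by algebra
    then show ?thesis by simp
  qed
  finally show ?case .
qed simp

lemma bdiff_pow_eventually_zero:
  assumes "\<And>j. m \<le> j \<Longrightarrow> c j = \<zero>" and "m \<le> j"
  shows "(bdiff R ^^ k) c j = \<zero>"
  using assms(2)
proof (induction k arbitrary: j)
  case (Suc k)
  then show ?case by (simp add: bdiff_def minus_eq)
qed (use assms in auto)

lemma regular_nat_pow:
  assumes "regular_element R x"
  shows "regular_element R (x [^] (k::nat))"
proof (induction k)
  case (Suc k)
  have x: "x \<in> carrier R" using assms by (simp add: regular_element_def)
  show ?case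
    unfolding regular_element_def
  proof (intro conjI ballI impI)
    fix b assume b: "b \<in> carrier R" and "x [^] Suc k \<otimes> b = \<zero>"
    then have "x [^] k \<otimes> (x \<otimes> b) = \<zero>" using x by (simp add: m_assoc)
    then have "x \<otimes> b = \<zero>" using Suc x b by (simp add: regular_element_def)
    then show "b = \<zero>" using assms b by (simp add: regular_element_def)
  qed (use x in simp)
qed (simp add: regular_element_def)

lemma regular_diff_commute:
  assumes "regular_element R (x \<ominus> y)" "x \<in> carrier R" "y \<in> carrier R"
  shows "regular_element R (y \<ominus> x)"
  unfolding regular_element_def
proof (intro conjI ballI impI)
  fix b assume b: "b \<in> carrier R" and 0: "(y \<ominus> x) \<otimes> b = \<zero>"
  have "(x \<ominus> y) \<otimes> b = \<ominus> ((y \<ominus> x) \<otimes> b)" using b assms(2,3) by algebra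
  then have "(x \<ominus> y) \<otimes> b = \<zero>" by (simp add: 0)
  then show "b = \<zero>" using assms(1) b by (simp add: regular_element_def)
qed (use assms in simp)

text \<open>
  The equation reads \<open>x * p (k + 1) = y * p k\<close>, so it makes the sequence \<open>p k * x ^ k\<close>
  geometric of ratio \<open>y\<close>. For a polynomial \<open>p\<close> and regular \<open>x - y\<close> this is impossible unless
  \<open>p = 0\<close>: the difference of \<open>p\<close> solves the same equation and has smaller degree, hence it
  vanishes, which leaves \<open>(x - y) p = 0\<close>.
\<close>

lemma bdiff_equation_unique:
  assumes reg: "regular_element R (x \<ominus> y)" and x: "x \<in> carrier R" and y: "y \<in> carrier R"
    and p: "\<And>k. p k \<in> carrier R"
    and nil: "\<And>k. (bdiff R ^^ d) p k = \<zero>"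
    and eq: "\<And>k. (x \<ominus> y) \<otimes> p k = x \<otimes> bdiff R p k"
  shows "p k = \<zero>"
  using p nil eq
proof (induction d arbitrary: p k)
  case (Suc d)
  have cl: "bdiff R p k \<in> carrier R" for k using Suc.prems(1) by (simp add: bdiff_def)
  have "bdiff R p k = \<zero>" for k
  proof (rule Suc.IH[OF cl])
    show "(bdiff R ^^ d) (bdiff R p) k = \<zero>" for k
      using Suc.prems(2)[of k] by (simp add: funpow_Suc_right del: funpow.simps)
    show "(x \<ominus> y) \<otimes> bdiff R p k = x \<otimes> bdiff R (bdiff R p) k" for k
    proof -
      have "(x \<ominus> y) \<otimes> bdiff R p k = (x \<ominus> y) \<otimes> p k \<ominus> (x \<ominus> y) \<otimes> p (Suc k)"
        unfolding bdiff_def using x y Suc.prems(1)[of k] Suc.prems(1)[of "Suc k"] by algebra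
      also have "\<dots> = x \<otimes> (bdiff R p k \<ominus> bdiff R p (Suc k))"
        unfolding Suc.prems(3) using x cl[of k] cl[of "Suc k"] by algebra
      finally show ?thesis by (simp add: bdiff_def)
    qed
  qed
  then have "(x \<ominus> y) \<otimes> p k = \<zero>" using Suc.prems(3)[of k] x by simp
  then show ?case using reg Suc.prems(1) by (simp add: regular_element_def)
qed simp

text \<open>
  Induction on the number of terms and, for a chosen term \<open>a\<close>, on the degree of \<open>p a\<close>. The operator
  that takes a sequence \<open>u\<close> to \<open>u (k + 1) - g a * u k\<close> sends \<open>p i k * g i ^ k\<close> to \<open>q i k * g i ^ k\<close>,
  where \<open>q i = (g i - g a) p i - g i (bdiff p i)\<close>. For \<open>i = a\<close> this has smaller degree than \<open>p a\<close>, so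
  all \<open>q i\<close> vanish by induction; then so does \<open>p i\<close> for \<open>i \<noteq> a\<close>, and the relation shrinks to
  \<open>p a k * g a ^ k = 0\<close>.
\<close>

lemma exponential_polynomials_independent:
  assumes "finite I"
    and g: "\<And>i. i \<in> I \<Longrightarrow> regular_element R (g i)"
    and gg: "\<And>i j. i \<in> I \<Longrightarrow> j \<in> I \<Longrightarrow> i \<noteq> j \<Longrightarrow> regular_element R (g i \<ominus> g j)"
    and p: "\<And>i k. i \<in> I \<Longrightarrow> p i k \<in> carrier R"
    and nil: "\<And>i. i \<in> I \<Longrightarrow> \<exists>d. \<forall>k. (bdiff R ^^ d) (p i) k = \<zero>"
    and zero: "\<And>k. (\<Oplus>i\<in>I. p i k \<otimes> g i [^] (k::nat)) = \<zero>"
    and i: "i \<in> I"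
  shows "p i k = \<zero>"
  using assms
proof (induction I arbitrary: p i k rule: finite_induct)
  case (insert a I)
  have gc: "g i \<in> carrier R" if "i \<in> insert a I" for i
    using insert.prems(1)[OF that] by (simp add: regular_element_def)
  note ac = gc[of a, simplified]
  \<comment> \<open>The statement is kept general in \<open>p\<close>, since the inner induction replaces \<open>p\<close> by \<open>q\<close>.\<close>
  obtain d where "\<forall>k. (bdiff R ^^ d) (p a) k = \<zero>" using insert.prems(4)[of a] by auto
  then have "\<forall>i\<in>insert a I. \<forall>k. p i k = \<zero>"
    using insert.prems(3,4,5)
  proof (induction d arbitrary: p)
    case 0
    have pa: "p a k = \<zero>" for k using 0(1) by simp
    moreover have "p i k = \<zero>" if "i \<in> I" for i k
    proof (rule insert.IH[OF _ _ _ _ _ that])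
      fix k
      have "(\<Oplus>i\<in>insert a I. p i k \<otimes> g i [^] k) = p a k \<otimes> g a [^] k \<oplus> (\<Oplus>i\<in>I. p i k \<otimes> g i [^] k)"
        using insert.hyps gc 0(2) by (intro finsum_insert) auto
      then show "(\<Oplus>i\<in>I. p i k \<otimes> g i [^] k) = \<zero>"
        using 0(4)[of k] pa[of k] gc 0(2)[of _ k] by (simp add: Pi_def)
    qed (use insert.prems(1,2) 0(2,3) in auto)
    ultimately show ?case by auto
  next
    case (Suc d)
    define q where "q i k = (g i \<ominus> g a) \<otimes> p i k \<ominus> g i \<otimes> bdiff R (p i) k" for i k
    have dc: "bdiff R (p i) k \<in> carrier R" if "i \<in> insert a I" for i k
      using Suc.prems(2)[OF that] by (simp add: bdiff_def)
    have qc: "q i k \<in> carrier R" if "i \<in> insert a I" for i k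
      using that gc[OF that] ac Suc.prems(2)[OF that] dc[OF that] by (simp add: q_def)
    have q_pow: "(bdiff R ^^ e) (q i) k
        = (g i \<ominus> g a) \<otimes> (bdiff R ^^ e) (p i) k \<ominus> g i \<otimes> (bdiff R ^^ Suc e) (p i) k"
      if "i \<in> insert a I" for i e k
      unfolding q_def funpow_Suc_right comp_def
      using gc[OF that] ac Suc.prems(2)[OF that] dc[OF that] by (intro bdiff_pow_linear) auto
    have q_nil: "\<exists>e. \<forall>k. (bdiff R ^^ e) (q i) k = \<zero>" if i: "i \<in> insert a I" for i
    proof -
      obtain e where e: "\<forall>k. (bdiff R ^^ e) (p i) k = \<zero>" using Suc.prems(3)[OF i] by auto
      have "(bdiff R ^^ e) (q i) k = \<zero>" for k
        using e gc[OF i] ac by (simp add: q_pow[OF i] bdiff_def minus_eq)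
      then show ?thesis by blast
    qed
    have qa_nil: "\<forall>k. (bdiff R ^^ d) (q a) k = \<zero>"
    proof
      fix k
      have "(bdiff R ^^ d) (p a) k \<in> carrier R"
        by (rule bdiff_pow_closed) (simp add: Suc.prems(2))
      then show "(bdiff R ^^ d) (q a) k = \<zero>"
        unfolding q_pow[OF insertI1] Suc.prems(1)[rule_format]
        using ac by (simp add: minus_eq r_neg)
    qed
    have q_sum: "(\<Oplus>i\<in>insert a I. q i k \<otimes> g i [^] k) = \<zero>" for k
    proof -
      have *: "q i k \<otimes> g i [^] k
          = p i (Suc k) \<otimes> g i [^] Suc k \<oplus> (\<ominus> g a) \<otimes> (p i k \<otimes> g i [^] k)"
        if i: "i \<in> insert a I" for i
      proof -
        have "q i k \<otimes> g i [^] k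
          = ((g i \<ominus> g a) \<otimes> p i k \<ominus> g i \<otimes> (p i k \<ominus> p i (Suc k))) \<otimes> g i [^] k"
          by (simp add: q_def bdiff_def)
        also have "\<dots> = p i (Suc k) \<otimes> (g i [^] k \<otimes> g i) \<oplus> (\<ominus> g a) \<otimes> (p i k \<otimes> g i [^] k)"
          using gc[OF i] ac Suc.prems(2)[OF i, of k] Suc.prems(2)[OF i, of "Suc k"]
            nat_pow_closed[OF gc[OF i], of k] by algebra
        finally show ?thesis by simp
      qed
      have "(\<Oplus>i\<in>insert a I. q i k \<otimes> g i [^] k)
          = (\<Oplus>i\<in>insert a I. p i (Suc k) \<otimes> g i [^] Suc k \<oplus> (\<ominus> g a) \<otimes> (p i k \<otimes> g i [^] k))"
        by (rule finsum_cong') (use * gc ac Suc.prems(2) in \<open>auto simp del: nat_pow_Suc\<close>)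
      also have "\<dots> = (\<Oplus>i\<in>insert a I. p i (Suc k) \<otimes> g i [^] Suc k)
          \<oplus> (\<Oplus>i\<in>insert a I. (\<ominus> g a) \<otimes> (p i k \<otimes> g i [^] k))"
        by (rule finsum_addf) (use gc ac Suc.prems(2) in auto)
      also have "(\<Oplus>i\<in>insert a I. (\<ominus> g a) \<otimes> (p i k \<otimes> g i [^] k))
          = (\<ominus> g a) \<otimes> (\<Oplus>i\<in>insert a I. p i k \<otimes> g i [^] k)"
        by (rule finsum_rdistr[symmetric]) (use gc ac Suc.prems(2) insert.hyps in auto)
      finally show ?thesis using ac by (simp only: Suc.prems(4)) simp
    qed
    have q0: "\<forall>i\<in>insert a I. \<forall>k. q i k = \<zero>"
      by (rule Suc.IH[OF qa_nil qc q_nil q_sum])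
    have pI: "p i k = \<zero>" if "i \<in> I" for i k
    proof -
      have i: "i \<in> insert a I" using that by simp
      obtain e where e: "\<And>k. (bdiff R ^^ e) (p i) k = \<zero>" using Suc.prems(3)[OF i] by auto
      have "i \<noteq> a" using that insert.hyps by auto
      then have "regular_element R (g i \<ominus> g a)" using insert.prems(2) i by simp
      then show ?thesis
      proof (rule bdiff_equation_unique[OF _ gc[OF i] ac _ e])
        fix k
        have "q i k = \<zero>" using q0 i by blast
        then show "(g i \<ominus> g a) \<otimes> p i k = g i \<otimes> bdiff R (p i) k"
          using gc[OF i] ac Suc.prems(2)[OF i] dc[OF i] by (simp add: q_def)
      qed (rule Suc.prems(2)[OF i])
    qed
    have "p a k = \<zero>" for k
    proof -
      have "(\<Oplus>i\<in>I. p i k \<otimes> g i [^] k) = (\<Oplus>i\<in>I. \<zero>)"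
        by (rule finsum_cong') (use pI gc in auto)
      moreover have "(\<Oplus>i\<in>insert a I. p i k \<otimes> g i [^] k)
          = p a k \<otimes> g a [^] k \<oplus> (\<Oplus>i\<in>I. p i k \<otimes> g i [^] k)"
        using insert.hyps gc Suc.prems(2) by (intro finsum_insert) auto
      ultimately have "g a [^] k \<otimes> p a k = \<zero>"
        using Suc.prems(4)[of k] Suc.prems(2)[of a k] ac by (simp add: m_comm)
      then show ?thesis
        using regular_nat_pow[OF insert.prems(1)[of a], of k] Suc.prems(2)[of a k]
        by (simp add: regular_element_def)
    qed
    then show ?case using pI by auto
  qed
  then show ?case using insert.prems(6) by blast
qed simp

end

section \<open>The universal property of the tensor product\<close>

definition balanced_map ::
  "('k, 'r) ring_scheme \<Rightarrow> ('k, 'a, 'm) module_scheme \<Rightarrow> ('k, 'b, 'n) module_scheme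
    \<Rightarrow> ('c, 'p) ring_scheme \<Rightarrow> ('a \<Rightarrow> 'b \<Rightarrow> 'c) \<Rightarrow> bool"
  where "balanced_map R M N P \<phi> \<longleftrightarrow>
    (\<forall>x\<in>carrier M. \<forall>y\<in>carrier N. \<phi> x y \<in> carrier P) \<and>
    (\<forall>x\<in>carrier M. \<forall>x'\<in>carrier M. \<forall>y\<in>carrier N. \<phi> (x \<oplus>\<^bsub>M\<^esub> x') y = \<phi> x y \<oplus>\<^bsub>P\<^esub> \<phi> x' y) \<and>
    (\<forall>x\<in>carrier M. \<forall>y\<in>carrier N. \<forall>y'\<in>carrier N. \<phi> x (y \<oplus>\<^bsub>N\<^esub> y') = \<phi> x y \<oplus>\<^bsub>P\<^esub> \<phi> x y') \<and>
    (\<forall>r\<in>carrier R. \<forall>x\<in>carrier M. \<forall>y\<in>carrier N. \<phi> (r \<odot>\<^bsub>M\<^esub> x) y = \<phi> x (r \<odot>\<^bsub>N\<^esub> y))"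

lemma balanced_mapI:
  assumes "\<And>x y. x \<in> carrier M \<Longrightarrow> y \<in> carrier N \<Longrightarrow> \<phi> x y \<in> carrier P"
    and "\<And>x x' y. x \<in> carrier M \<Longrightarrow> x' \<in> carrier M \<Longrightarrow> y \<in> carrier N
      \<Longrightarrow> \<phi> (x \<oplus>\<^bsub>M\<^esub> x') y = \<phi> x y \<oplus>\<^bsub>P\<^esub> \<phi> x' y"
    and "\<And>x y y'. x \<in> carrier M \<Longrightarrow> y \<in> carrier N \<Longrightarrow> y' \<in> carrier N
      \<Longrightarrow> \<phi> x (y \<oplus>\<^bsub>N\<^esub> y') = \<phi> x y \<oplus>\<^bsub>P\<^esub> \<phi> x y'"
    and "\<And>r x y. r \<in> carrier R \<Longrightarrow> x \<in> carrier M \<Longrightarrow> y \<in> carrier N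
      \<Longrightarrow> \<phi> (r \<odot>\<^bsub>M\<^esub> x) y = \<phi> x (r \<odot>\<^bsub>N\<^esub> y)"
  shows "balanced_map R M N P \<phi>"
  using assms unfolding balanced_map_def by blast

lemma balanced_mapD:
  assumes "balanced_map R M N P \<phi>" "x \<in> carrier M" "y \<in> carrier N"
  shows "\<phi> x y \<in> carrier P"
    and "x' \<in> carrier M \<Longrightarrow> \<phi> (x \<oplus>\<^bsub>M\<^esub> x') y = \<phi> x y \<oplus>\<^bsub>P\<^esub> \<phi> x' y"
    and "y' \<in> carrier N \<Longrightarrow> \<phi> x (y \<oplus>\<^bsub>N\<^esub> y') = \<phi> x y \<oplus>\<^bsub>P\<^esub> \<phi> x y'"
    and "r \<in> carrier R \<Longrightarrow> \<phi> (r \<odot>\<^bsub>M\<^esub> x) y = \<phi> x (r \<odot>\<^bsub>N\<^esub> y)"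
  using assms unfolding balanced_map_def by blast+

text \<open>
  The additive extension of \<open>f\<close> to formal sums is spelled out here, because this explicit sum is
  the one that occurs in the definition of \<^const>\<open>tensor_lift\<close>.
\<close>

lemma (in abelian_group) free_Abelian_group_extension_hom:
  fixes f :: "'c \<Rightarrow> 'a"
  assumes f: "f \<in> S \<rightarrow> carrier G"
  defines "h \<equiv> \<lambda>c. \<Oplus>p\<in>Poly_Mapping.keys c. add_pow G (Poly_Mapping.lookup c p) (f p)"
  shows "h \<in> hom (free_Abelian_group S) (add_monoid G)"
    and "\<And>p. p \<in> S \<Longrightarrow> h (frag_of p) = f p"
proof -
  have pow_cl: "add_pow G (n::int) (f p) \<in> carrier G" if "p \<in> S" for n p
    using add.int_pow_closed[of "f p" n] f that by auto
  have h_eq: "h c = (\<Oplus>p\<in>U. add_pow G (Poly_Mapping.lookup c p) (f p))"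
    if "finite U" "Poly_Mapping.keys c \<subseteq> U" "U \<subseteq> S" for U c
    unfolding h_def
  proof (rule add.finprod_mono_neutral_cong)
    fix p assume "p \<in> U - Poly_Mapping.keys c"
    then have "Poly_Mapping.lookup c p = 0" by (simp add: in_keys_iff)
    then show "add_pow G (Poly_Mapping.lookup c p) (f p) = \<zero>"
      by (simp add: add_pow_def)
  qed (use that pow_cl in auto)
  show "h \<in> hom (free_Abelian_group S) (add_monoid G)"
  proof (rule homI)
    fix a assume "a \<in> carrier (free_Abelian_group S)"
    then show "h a \<in> carrier (add_monoid G)"
      using pow_cl unfolding h_def by (auto intro!: finsum_closed)
  next
    fix a b assume "a \<in> carrier (free_Abelian_group S)" "b \<in> carrier (free_Abelian_group S)"
    then have ab: "Poly_Mapping.keys a \<subseteq> S" "Poly_Mapping.keys b \<subseteq> S" by auto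
    define U where "U = Poly_Mapping.keys a \<union> Poly_Mapping.keys b"
    have U: "finite U" "U \<subseteq> S" "Poly_Mapping.keys a \<subseteq> U" "Poly_Mapping.keys b \<subseteq> U"
      "Poly_Mapping.keys (a + b) \<subseteq> U"
      using ab keys_add[of a b] by (auto simp: U_def)
    have "h (a + b) = (\<Oplus>p\<in>U. add_pow G (Poly_Mapping.lookup (a + b) p) (f p))"
      by (rule h_eq) (use U in auto)
    also have "\<dots> = (\<Oplus>p\<in>U. add_pow G (Poly_Mapping.lookup a p) (f p)
        \<oplus> add_pow G (Poly_Mapping.lookup b p) (f p))"
    proof (rule finsum_cong')
      fix p assume "p \<in> U"
      then have "f p \<in> carrier G" using U(2) f by auto
      then show "add_pow G (Poly_Mapping.lookup (a + b) p) (f p)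
          = add_pow G (Poly_Mapping.lookup a p) (f p) \<oplus> add_pow G (Poly_Mapping.lookup b p) (f p)"
        using add.int_pow_mult[of "f p"] by (simp add: lookup_add)
    qed (use U pow_cl in auto)
    also have "\<dots> = h a \<oplus> h b"
      using U pow_cl by (subst finsum_addf) (auto simp: h_eq[of U])
    finally show "h (a \<otimes>\<^bsub>free_Abelian_group S\<^esub> b) = h a \<otimes>\<^bsub>add_monoid G\<^esub> h b" by simp
  qed
  fix p assume p: "p \<in> S"
  then have "add_pow G (1::int) (f p) = f p"
    using add.int_pow_1[of "f p"] funcset_mem[OF f] by simp
  then show "h (frag_of p) = f p"
    using h_eq[of "{p}" "frag_of p"] p f by (auto simp: Pi_def)
qed

text \<open>
  Used for two records with the same additive structure: the bare group of the tensor product and the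
  module that extends it.
\<close>

lemma abelian_group_of_comm_group:
  fixes P :: "('a, 'p) ring_scheme" and G :: "('a, 'q) monoid_scheme"
  assumes "comm_group G" and [simp]: "carrier P = carrier G" "ring.add P = monoid.mult G"
    "ring.zero P = \<one>\<^bsub>G\<^esub>"
  shows "abelian_group P"
proof -
  interpret comm_group G by fact
  show ?thesis
    by (rule abelian_groupI) (auto simp: m_ac intro: l_inv_ex)
qed

locale module_pair = M: module R M + N: module R N
  for R :: "('k, 'r) ring_scheme"
    and M :: "('k, 'a, 'm) module_scheme"
    and N :: "('k, 'b, 'n) module_scheme"
begin

abbreviation "F \<equiv> tensor_free M N"
abbreviation "K \<equiv> tensor_kernel R M N"
abbreviation "T \<equiv> tensor_group R M N"

abbreviation tensor_class :: "(('a \<times> 'b) \<Rightarrow>\<^sub>0 int) \<Rightarrow> (('a \<times> 'b) \<Rightarrow>\<^sub>0 int) set"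
  where "tensor_class c \<equiv> K #>\<^bsub>F\<^esub> c"

lemma tensor_relators_subset: "tensor_relators R M N \<subseteq> carrier F"
proof -
  have "Poly_Mapping.keys (frag_of p - frag_of q) \<subseteq> S"
    if "p \<in> S" "q \<in> S" for p q and S :: "('a \<times> 'b) set"
    by (rule order_trans[OF keys_diff]) (use that in auto)
  moreover have "Poly_Mapping.keys (frag_of p - frag_of q - frag_of s) \<subseteq> S"
    if "p \<in> S" "q \<in> S" "s \<in> S" for p q s and S :: "('a \<times> 'b) set"
    by (rule order_trans[OF keys_diff]) (use that calculation[of p S q] in auto)
  ultimately show ?thesis
    unfolding tensor_relators_def by auto
qed

lemma subgroup_tensor_kernel: "subgroup K F"
  unfolding tensor_kernel_def
  by (rule group.generate_is_subgroup[OF group_free_Abelian_group tensor_relators_subset])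

lemma normal_tensor_kernel: "K \<lhd> F"
  using comm_group.normal_iff_subgroup[OF abelian_free_Abelian_group] subgroup_tensor_kernel by blast

lemma tensor_group_simps:
  "carrier T = carrier (F Mod K)"
  "ring.zero T = \<one>\<^bsub>F Mod K\<^esub>"
  "ring.add T = monoid.mult (F Mod K)"
  by (simp_all add: tensor_group_def Let_def)

lemma tensor_simps:
  "carrier (tensor R M N) = carrier T"
  "ring.zero (tensor R M N) = ring.zero T"
  "ring.add (tensor R M N) = ring.add T"
  by (simp_all add: tensor_def Let_def)

lemma abelian_group_tensor_group: "abelian_group T"
  by (rule abelian_group_of_comm_group[OF comm_group.abelian_FactGroup[OF
        abelian_free_Abelian_group subgroup_tensor_kernel]])
     (simp_all add: tensor_group_simps)

lemma abelian_group_tensor: "abelian_group (tensor R M N)"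
  by (rule abelian_group_of_comm_group[OF comm_group.abelian_FactGroup[OF
        abelian_free_Abelian_group subgroup_tensor_kernel]])
     (simp_all add: tensor_group_simps tensor_simps)

lemma tensor_class_add:
  assumes "a \<in> carrier F" "b \<in> carrier F"
  shows "tensor_class a \<oplus>\<^bsub>T\<^esub> tensor_class b = tensor_class (a + b)"
  using normal.rcos_sum[OF normal_tensor_kernel assms] by (simp add: tensor_group_simps)

lemma tensor_carrier_cases:
  assumes "t \<in> carrier T"
  obtains c where "c \<in> carrier F" "t = tensor_class c"
  using assms by (auto simp: tensor_group_simps FactGroup_def RCOSETS_def)

lemma tensor_class_closed: "c \<in> carrier F \<Longrightarrow> tensor_class c \<in> carrier T"
  by (auto simp: tensor_group_simps FactGroup_def RCOSETS_def)

lemma tensor_class_eqI: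
  assumes "a \<in> carrier F" "b \<in> carrier F" "a - b \<in> K"
  shows "tensor_class a = tensor_class b"
proof -
  have "a = (a - b) \<otimes>\<^bsub>F\<^esub> b" by simp
  then have "a \<in> tensor_class b" unfolding r_coset_def using assms(3) by blast
  then show ?thesis
    using group.repr_independence[OF group_free_Abelian_group _ assms(2) subgroup_tensor_kernel]
    by metis
qed

lemma balanced_pure_tensor: "balanced_map R M N T (pure_tensor R M N)"
proof (rule balanced_mapI)
  have rel: "c \<in> K" if "c \<in> tensor_relators R M N" for c
    unfolding tensor_kernel_def using that by (rule generate.incl)
  note eqI = tensor_class_eqI[OF _ _ rel]
  have pt: "pure_tensor R M N x y \<oplus>\<^bsub>T\<^esub> pure_tensor R M N x' y'
      = tensor_class (frag_of (x, y) + frag_of (x', y'))"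
    if "x \<in> carrier M" "y \<in> carrier N" "x' \<in> carrier M" "y' \<in> carrier N" for x y x' y'
    unfolding pure_tensor_def by (rule tensor_class_add) (use that in auto)
  have sum: "frag_of p + frag_of q \<in> carrier F"
    if "p \<in> carrier M \<times> carrier N" "q \<in> carrier M \<times> carrier N" for p q
    using that keys_add[of "frag_of p" "frag_of q"] by auto
  show "pure_tensor R M N x y \<in> carrier T" if "x \<in> carrier M" "y \<in> carrier N" for x y
    unfolding pure_tensor_def by (rule tensor_class_closed) (use that in simp)
  show "pure_tensor R M N (x \<oplus>\<^bsub>M\<^esub> x') y = pure_tensor R M N x y \<oplus>\<^bsub>T\<^esub> pure_tensor R M N x' y"
    if "x \<in> carrier M" "x' \<in> carrier M" "y \<in> carrier N" for x x' y
    unfolding pt[OF that(1,3,2,3)] unfolding pure_tensor_def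
    by (rule eqI) (use that sum in \<open>auto simp: tensor_relators_def diff_diff_eq[symmetric]\<close>)
  show "pure_tensor R M N x (y \<oplus>\<^bsub>N\<^esub> y') = pure_tensor R M N x y \<oplus>\<^bsub>T\<^esub> pure_tensor R M N x y'"
    if "x \<in> carrier M" "y \<in> carrier N" "y' \<in> carrier N" for x y y'
    unfolding pt[OF that(1,2,1,3)] unfolding pure_tensor_def
    by (rule eqI) (use that sum in \<open>auto simp: tensor_relators_def diff_diff_eq[symmetric]\<close>)
  show "pure_tensor R M N (r \<odot>\<^bsub>M\<^esub> x) y = pure_tensor R M N x (r \<odot>\<^bsub>N\<^esub> y)"
    if "r \<in> carrier R" "x \<in> carrier M" "y \<in> carrier N" for r x y
    unfolding pure_tensor_def
    by (rule eqI) (use that in \<open>auto simp: tensor_relators_def\<close>)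
qed

lemma pure_tensor_closed:
  "x \<in> carrier M \<Longrightarrow> y \<in> carrier N \<Longrightarrow> pure_tensor R M N x y \<in> carrier T"
  by (rule balanced_mapD(1)[OF balanced_pure_tensor])

text \<open>
  Pure tensors generate the tensor product additively. Negatives require no case of their own, since
  \<open>- (x \<otimes> y) = (- x) \<otimes> y\<close>; likewise \<open>0 = 0 \<otimes> 0\<close>.
\<close>

lemma tensor_induct [consumes 1, case_names pure add]:
  assumes "t \<in> carrier T"
    and pure: "\<And>x y. x \<in> carrier M \<Longrightarrow> y \<in> carrier N \<Longrightarrow> P (pure_tensor R M N x y)"
    and add: "\<And>s t. s \<in> carrier T \<Longrightarrow> t \<in> carrier T \<Longrightarrow> P s \<Longrightarrow> P t \<Longrightarrow> P (s \<oplus>\<^bsub>T\<^esub> t)"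
  shows "P t"
proof -
  interpret T: abelian_group T by (rule abelian_group_tensor_group)
  note bal = balanced_mapD[OF balanced_pure_tensor]
  obtain c where c: "c \<in> carrier F" "t = tensor_class c"
    using assms(1) by (rule tensor_carrier_cases)
  have class_zero: "tensor_class 0 = pure_tensor R M N \<zero>\<^bsub>M\<^esub> \<zero>\<^bsub>N\<^esub>"
  proof -
    have "tensor_class 0 \<oplus>\<^bsub>T\<^esub> tensor_class 0 = tensor_class 0" using tensor_class_add[of 0 0] by simp
    then have "tensor_class 0 = \<zero>\<^bsub>T\<^esub>"
      using tensor_class_closed[of 0] T.add.l_cancel_one by fastforce
    moreover have "pure_tensor R M N \<zero>\<^bsub>M\<^esub> \<zero>\<^bsub>N\<^esub> \<oplus>\<^bsub>T\<^esub> pure_tensor R M N \<zero>\<^bsub>M\<^esub> \<zero>\<^bsub>N\<^esub>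
        = pure_tensor R M N \<zero>\<^bsub>M\<^esub> \<zero>\<^bsub>N\<^esub>"
      using bal(2)[of "\<zero>\<^bsub>M\<^esub>" "\<zero>\<^bsub>N\<^esub>" "\<zero>\<^bsub>M\<^esub>"] by simp
    then have "pure_tensor R M N \<zero>\<^bsub>M\<^esub> \<zero>\<^bsub>N\<^esub> = \<zero>\<^bsub>T\<^esub>"
      using pure_tensor_closed[of "\<zero>\<^bsub>M\<^esub>" "\<zero>\<^bsub>N\<^esub>"] T.add.l_cancel_one by fastforce
    ultimately show ?thesis by simp
  qed
  have "Poly_Mapping.keys c \<subseteq> carrier M \<times> carrier N" using c(1) by simp
  \<comment> \<open>Carrying the negative along turns the differences of the induction on \<open>c\<close> into sums.\<close>
  then have "P (tensor_class c) \<and> P (tensor_class (- c))"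
  proof (induction c rule: free_Abelian_group_induct[consumes 1, case_names zero diff gen])
    case zero
    then show ?case using pure[of "\<zero>\<^bsub>M\<^esub>" "\<zero>\<^bsub>N\<^esub>"] by (simp add: class_zero)
  next
    case (diff a b)
    then have cl: "a \<in> carrier F" "b \<in> carrier F" "- a \<in> carrier F" "- b \<in> carrier F"
      by (auto simp: keys_minus)
    note tc = tensor_class_closed[OF cl(1)] tensor_class_closed[OF cl(2)]
      tensor_class_closed[OF cl(3)] tensor_class_closed[OF cl(4)]
    have "tensor_class (a - b) = tensor_class a \<oplus>\<^bsub>T\<^esub> tensor_class (- b)"
      using tensor_class_add[OF cl(1,4)] by simp
    moreover have "tensor_class (- (a - b)) = tensor_class b \<oplus>\<^bsub>T\<^esub> tensor_class (- a)"
      using tensor_class_add[OF cl(2,3)] by simp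
    ultimately show ?case using diff(3,4) tc add by simp
  next
    case (gen p)
    then obtain x y where p: "p = (x, y)" and x: "x \<in> carrier M" and y: "y \<in> carrier N" by auto
    have nx: "\<ominus>\<^bsub>M\<^esub> x \<in> carrier M" using x by simp
    have f: "- frag_of (x, y) \<in> carrier F" using x y by simp
    have "tensor_class (- frag_of (x, y)) = pure_tensor R M N (\<ominus>\<^bsub>M\<^esub> x) y"
    proof -
      have z: "pure_tensor R M N \<zero>\<^bsub>M\<^esub> y = \<zero>\<^bsub>T\<^esub>"
        using bal(2)[of "\<zero>\<^bsub>M\<^esub>" y "\<zero>\<^bsub>M\<^esub>"] pure_tensor_closed[of "\<zero>\<^bsub>M\<^esub>" y] y
          T.add.l_cancel_one by fastforce
      have "pure_tensor R M N x y \<oplus>\<^bsub>T\<^esub> pure_tensor R M N (\<ominus>\<^bsub>M\<^esub> x) y = \<zero>\<^bsub>T\<^esub>"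
        using bal(2)[OF x y nx] x z by (simp add: M.r_neg)
      moreover have "pure_tensor R M N x y \<oplus>\<^bsub>T\<^esub> tensor_class (- frag_of (x, y)) = \<zero>\<^bsub>T\<^esub>"
      proof -
        have "pure_tensor R M N x y \<oplus>\<^bsub>T\<^esub> tensor_class (- frag_of (x, y)) = tensor_class 0"
          unfolding pure_tensor_def by (subst tensor_class_add) (use x y f in auto)
        also have "\<dots> = \<zero>\<^bsub>T\<^esub>"
          using tensor_class_add[of 0 0] tensor_class_closed[of 0] T.add.l_cancel_one by fastforce
        finally show ?thesis .
      qed
      ultimately show ?thesis
        using pure_tensor_closed[OF x y] pure_tensor_closed[OF nx y] tensor_class_closed[OF f]
        by (metis T.add.l_cancel)
    qed
    then show ?case using pure[OF x y] pure[OF nx y] by (simp add: p pure_tensor_def)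
  qed
  then show ?thesis using c by simp
qed

context
  fixes P :: "('c, 'p) ring_scheme" and \<phi> :: "'a \<Rightarrow> 'b \<Rightarrow> 'c"
  assumes P: "abelian_group P" and \<phi>: "balanced_map R M N P \<phi>"
begin

text \<open>
  The universal property. The additive extension of \<open>\<phi>\<close> to formal sums kills the relators, because
  \<open>\<phi>\<close> is balanced, and therefore the subgroup that they generate. So it is constant on each coset,
  and the set whose only element \<^const>\<open>tensor_lift\<close> picks is a singleton.
\<close>

lemma tensor_lift_properties:
  shows tensor_lift_closed: "t \<in> carrier T \<Longrightarrow> tensor_lift P \<phi> t \<in> carrier P"
    and tensor_lift_add: "s \<in> carrier T \<Longrightarrow> t \<in> carrier T
      \<Longrightarrow> tensor_lift P \<phi> (s \<oplus>\<^bsub>T\<^esub> t) = tensor_lift P \<phi> s \<oplus>\<^bsub>P\<^esub> tensor_lift P \<phi> t"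
    and tensor_lift_pure: "x \<in> carrier M \<Longrightarrow> y \<in> carrier N
      \<Longrightarrow> tensor_lift P \<phi> (pure_tensor R M N x y) = \<phi> x y"
proof -
  interpret P: abelian_group P by (rule P)
  note bal = balanced_mapD[OF \<phi>]
  define h :: "(('a \<times> 'b) \<Rightarrow>\<^sub>0 int) \<Rightarrow> 'c"
    where "h c = (\<Oplus>\<^bsub>P\<^esub>p\<in>Poly_Mapping.keys c.
      add_pow P (Poly_Mapping.lookup c p) (\<phi> (fst p) (snd p)))" for c
  have "(\<lambda>p. \<phi> (fst p) (snd p)) \<in> carrier M \<times> carrier N \<rightarrow> carrier P" using bal(1) by auto
  note ext = P.free_Abelian_group_extension_hom[OF this, folded h_def]
  have hfrag: "h (frag_of (x, y)) = \<phi> x y" if "x \<in> carrier M" "y \<in> carrier N" for x y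
    using ext(2)[of "(x, y)"] that by simp
  interpret h: group_hom F "add_monoid P" h
    using ext(1) by (intro group_hom.intro group_hom_axioms.intro) (auto intro: P.a_group)
  have hc: "h c \<in> carrier P" if "c \<in> carrier F" for c using h.hom_closed[OF that] by simp
  have hadd: "h (a + b) = h a \<oplus>\<^bsub>P\<^esub> h b" if "a \<in> carrier F" "b \<in> carrier F" for a b
    using h.hom_mult[OF that] by simp
  have hdiff: "h (a - b) = h a \<ominus>\<^bsub>P\<^esub> h b" if "a \<in> carrier F" "b \<in> carrier F" for a b
  proof -
    have "h (- b) = \<ominus>\<^bsub>P\<^esub> h b" using h.hom_inv[OF that(2)] that(2) by (simp add: a_inv_def)
    moreover have "- b \<in> carrier F" using that(2) by simp
    ultimately show ?thesis using hadd[OF that(1), of "- b"] by (simp add: P.minus_eq)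
  qed
  have fr: "frag_of (x, y) \<in> carrier F" if "x \<in> carrier M" "y \<in> carrier N" for x y
    using that by simp
  have frd: "frag_of (x, y) - frag_of (x', y') \<in> carrier F"
    if "x \<in> carrier M" "y \<in> carrier N" "x' \<in> carrier M" "y' \<in> carrier N" for x y x' y'
    using keys_diff[of "frag_of (x, y)" "frag_of (x', y')"] that by auto
  have rel: "tensor_relators R M N \<subseteq> kernel F (add_monoid P) h"
  proof
    fix c assume c: "c \<in> tensor_relators R M N"
    have cancel: "a \<oplus>\<^bsub>P\<^esub> b \<oplus>\<^bsub>P\<^esub> \<ominus>\<^bsub>P\<^esub> a \<oplus>\<^bsub>P\<^esub> \<ominus>\<^bsub>P\<^esub> b = \<zero>\<^bsub>P\<^esub>"
      if "a \<in> carrier P" "b \<in> carrier P" for a b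
    proof -
      have "a \<oplus>\<^bsub>P\<^esub> b \<oplus>\<^bsub>P\<^esub> \<ominus>\<^bsub>P\<^esub> a = b"
        using that by (simp add: P.a_comm[of a b] P.a_assoc P.r_neg)
      then show ?thesis using that by (simp add: P.r_neg)
    qed
    have "h c = \<zero>\<^bsub>P\<^esub>"
      using c unfolding tensor_relators_def
      by (auto simp: hdiff fr frd hfrag bal cancel P.minus_eq P.r_neg
        simp del: carrier_free_Abelian_group_iff)
    then show "c \<in> kernel F (add_monoid P) h"
      using c tensor_relators_subset by (auto simp: kernel_def simp del: carrier_free_Abelian_group_iff)
  qed
  have hK: "h k = \<zero>\<^bsub>P\<^esub>" if "k \<in> K" for k
    using h.generate_subgroup_incl[OF rel h.subgroup_kernel] that
    unfolding tensor_kernel_def kernel_def by auto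
  have KF: "K \<subseteq> carrier F" using subgroup_tensor_kernel by (rule subgroup.subset)
  have lift: "tensor_lift P \<phi> (tensor_class c) = h c" if c: "c \<in> carrier F" for c
  proof -
    have "h d = h c" if d: "d \<in> tensor_class c" for d
    proof -
      obtain k where "k \<in> K" "d = k + c"
        using d unfolding r_coset_def by auto
      then show ?thesis using hadd[of k c] c KF hK hc[OF c] by auto
    qed
    moreover have "c \<in> tensor_class c"
      by (rule group.rcos_self[OF group_free_Abelian_group c subgroup_tensor_kernel])
    ultimately have "h ` tensor_class c = {h c}" by blast
    then show ?thesis unfolding tensor_lift_def h_def[symmetric] by simp
  qed
  show "tensor_lift P \<phi> t \<in> carrier P" if "t \<in> carrier T"
    using that by (elim tensor_carrier_cases) (simp add: lift hc del: carrier_free_Abelian_group_iff)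
  show "tensor_lift P \<phi> (s \<oplus>\<^bsub>T\<^esub> t) = tensor_lift P \<phi> s \<oplus>\<^bsub>P\<^esub> tensor_lift P \<phi> t"
    if st: "s \<in> carrier T" "t \<in> carrier T"
  proof -
    obtain a b where ab: "a \<in> carrier F" "s = tensor_class a" "b \<in> carrier F" "t = tensor_class b"
      using st by (metis tensor_carrier_cases)
    have "a + b \<in> carrier F" using ab keys_add[of a b] by auto
    then show ?thesis
      using ab by (simp add: tensor_class_add lift hadd del: carrier_free_Abelian_group_iff)
  qed
  show "tensor_lift P \<phi> (pure_tensor R M N x y) = \<phi> x y" if "x \<in> carrier M" "y \<in> carrier N"
    unfolding pure_tensor_def using lift[OF fr[OF that]] hfrag[OF that] by simp
qed

end

end

context module_pair
begin

lemma tensor_lift_cong: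
  assumes P: "abelian_group P" and \<phi>: "balanced_map R M N P \<phi>" and \<psi>: "balanced_map R M N P \<psi>"
    and eq: "\<And>x y. x \<in> carrier M \<Longrightarrow> y \<in> carrier N \<Longrightarrow> \<phi> x y = \<psi> x y"
    and t: "t \<in> carrier T"
  shows "tensor_lift P \<phi> t = tensor_lift P \<psi> t"
  using t
  by (induction t rule: tensor_induct)
     (simp_all add: eq tensor_lift_pure[OF P \<phi>] tensor_lift_pure[OF P \<psi>]
        tensor_lift_add[OF P \<phi>] tensor_lift_add[OF P \<psi>])

lemma tensor_lift_sum:
  assumes P: "abelian_group P" and \<phi>: "balanced_map R M N P \<phi>" and \<psi>: "balanced_map R M N P \<psi>"
    and \<chi>: "balanced_map R M N P \<chi>"
    and eq: "\<And>x y. x \<in> carrier M \<Longrightarrow> y \<in> carrier N \<Longrightarrow> \<chi> x y = \<phi> x y \<oplus>\<^bsub>P\<^esub> \<psi> x y"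
    and t: "t \<in> carrier T"
  shows "tensor_lift P \<chi> t = tensor_lift P \<phi> t \<oplus>\<^bsub>P\<^esub> tensor_lift P \<psi> t"
proof -
  interpret P: abelian_group P by (rule P)
  show ?thesis
    using t
    by (induction t rule: tensor_induct)
       (simp_all add: eq tensor_lift_pure[OF P \<phi>] tensor_lift_pure[OF P \<psi>] tensor_lift_pure[OF P \<chi>]
        tensor_lift_add[OF P \<phi>] tensor_lift_add[OF P \<psi>] tensor_lift_add[OF P \<chi>]
        tensor_lift_closed[OF P \<phi>] tensor_lift_closed[OF P \<psi>] P.a_ac)
qed

lemma tensor_lift_diff:
  assumes P: "abelian_group P" and \<phi>: "balanced_map R M N P \<phi>" and \<psi>: "balanced_map R M N P \<psi>"
    and \<chi>: "balanced_map R M N P \<chi>"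
    and eq: "\<And>x y. x \<in> carrier M \<Longrightarrow> y \<in> carrier N \<Longrightarrow> \<chi> x y = \<phi> x y \<ominus>\<^bsub>P\<^esub> \<psi> x y"
    and t: "t \<in> carrier T"
  shows "tensor_lift P \<chi> t = tensor_lift P \<phi> t \<ominus>\<^bsub>P\<^esub> tensor_lift P \<psi> t"
proof -
  interpret P: abelian_group P by (rule P)
  have "\<phi> x y = \<chi> x y \<oplus>\<^bsub>P\<^esub> \<psi> x y" if "x \<in> carrier M" "y \<in> carrier N" for x y
    using balanced_mapD(1)[OF \<phi> that] balanced_mapD(1)[OF \<psi> that]
    by (simp add: eq[OF that] P.minus_eq P.a_assoc P.l_neg)
  then have "tensor_lift P \<phi> t = tensor_lift P \<chi> t \<oplus>\<^bsub>P\<^esub> tensor_lift P \<psi> t"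
    by (rule tensor_lift_sum[OF P \<chi> \<psi> \<phi> _ t])
  then show ?thesis
    using tensor_lift_closed[OF P \<chi> t] tensor_lift_closed[OF P \<psi> t]
    by (simp add: P.minus_eq P.a_assoc P.r_neg)
qed

lemma balanced_pure_tensor': "balanced_map R M N (tensor R M N) (pure_tensor R M N)"
  using balanced_pure_tensor by (simp add: balanced_map_def tensor_simps)

lemma balanced_pure_tensor_smult:
  assumes r: "r \<in> carrier R"
  shows "balanced_map R M N T (\<lambda>x y. pure_tensor R M N (r \<odot>\<^bsub>M\<^esub> x) y)"
proof (rule balanced_mapI)
  note bal = balanced_mapD[OF balanced_pure_tensor]
  show "pure_tensor R M N (r \<odot>\<^bsub>M\<^esub> (s \<odot>\<^bsub>M\<^esub> x)) y = pure_tensor R M N (r \<odot>\<^bsub>M\<^esub> x) (s \<odot>\<^bsub>N\<^esub> y)"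
    if s: "s \<in> carrier R" and x: "x \<in> carrier M" and y: "y \<in> carrier N" for s x y
  proof -
    have "r \<odot>\<^bsub>M\<^esub> (s \<odot>\<^bsub>M\<^esub> x) = s \<odot>\<^bsub>M\<^esub> (r \<odot>\<^bsub>M\<^esub> x)"
      using r s x by (metis M.smult_assoc1 M.R.m_comm)
    then show ?thesis using r s x y by (simp add: bal)
  qed
qed (use r in \<open>simp_all add: balanced_mapD[OF balanced_pure_tensor] M.smult_r_distr\<close>)

lemma tensor_smult:
  "r \<odot>\<^bsub>tensor R M N\<^esub> t = tensor_lift T (\<lambda>x y. pure_tensor R M N (r \<odot>\<^bsub>M\<^esub> x) y) t"
  by (simp add: tensor_def Let_def)

lemma tensor_lift_smult:
  assumes L: "module R L" and \<phi>: "balanced_map R M N L \<phi>"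
    and lin: "\<And>x y. x \<in> carrier M \<Longrightarrow> y \<in> carrier N \<Longrightarrow> \<phi> (r \<odot>\<^bsub>M\<^esub> x) y = r \<odot>\<^bsub>L\<^esub> \<phi> x y"
    and r: "r \<in> carrier R" and t: "t \<in> carrier T"
  shows "tensor_lift L \<phi> (r \<odot>\<^bsub>tensor R M N\<^esub> t) = r \<odot>\<^bsub>L\<^esub> tensor_lift L \<phi> t"
proof -
  interpret L: module R L by (rule L)
  note sm = balanced_pure_tensor_smult[OF r]
  note T = abelian_group_tensor_group
  have L': "abelian_group L" by (rule L.M.abelian_group_axioms)
  show ?thesis
    unfolding tensor_smult using t
    by (induction t rule: tensor_induct)
       (simp_all add: r lin tensor_lift_pure[OF T sm] tensor_lift_pure[OF L' \<phi>]
          tensor_lift_add[OF T sm] tensor_lift_add[OF L' \<phi>] tensor_lift_closed[OF T sm]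
          tensor_lift_closed[OF L' \<phi>] L.smult_r_distr)
qed

end

lemma linear_mapsI:
  assumes "\<And>x. x \<in> carrier M \<Longrightarrow> f x \<in> carrier N"
    and "\<And>x y. x \<in> carrier M \<Longrightarrow> y \<in> carrier M \<Longrightarrow> f (x \<oplus>\<^bsub>M\<^esub> y) = f x \<oplus>\<^bsub>N\<^esub> f y"
    and "\<And>r x. r \<in> carrier R \<Longrightarrow> x \<in> carrier M \<Longrightarrow> f (r \<odot>\<^bsub>M\<^esub> x) = r \<odot>\<^bsub>N\<^esub> f x"
  shows "f \<in> linear_maps R M N"
  using assms by (auto simp: linear_maps_def)

lemma linear_mapsD:
  assumes "f \<in> linear_maps R M N" "x \<in> carrier M"
  shows "f x \<in> carrier N"
    and "y \<in> carrier M \<Longrightarrow> f (x \<oplus>\<^bsub>M\<^esub> y) = f x \<oplus>\<^bsub>N\<^esub> f y"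
    and "r \<in> carrier R \<Longrightarrow> f (r \<odot>\<^bsub>M\<^esub> x) = r \<odot>\<^bsub>N\<^esub> f x"
  using assms by (auto simp: linear_maps_def)

lemma balanced_map_comp:
  assumes "balanced_map R M' N' P \<phi>" "f \<in> linear_maps R M M'" "g \<in> linear_maps R N N'"
  shows "balanced_map R M N P (\<lambda>x y. \<phi> (f x) (g y))"
  by (rule balanced_mapI)
     (simp_all add: balanced_mapD[OF assms(1)] linear_mapsD[OF assms(2)] linear_mapsD[OF assms(3)])

text \<open>
  Serves twice: with the multiplication of \<open>B\<close> as \<open>\<phi>\<close> it computes convolutions, and with one factor
  mapped by the counit it makes the counit axioms applicable.
\<close>

lemma tensor_lift_tensor_map:
  assumes "module_pair R M N" "module_pair R M' N'"
    and f: "f \<in> linear_maps R M M'" and g: "g \<in> linear_maps R N N'"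
    and P: "abelian_group P" and \<phi>: "balanced_map R M' N' P \<phi>"
    and t: "t \<in> carrier (tensor_group R M N)"
  shows "tensor_lift P \<phi> (tensor_map R M' N' f g t) = tensor_lift P (\<lambda>x y. \<phi> (f x) (g y)) t"
proof -
  interpret A: module_pair R M N by fact
  interpret B: module_pair R M' N' by fact
  note T = B.abelian_group_tensor
  note fg = balanced_map_comp[OF B.balanced_pure_tensor' f g]
  note \<phi>fg = balanced_map_comp[OF \<phi> f g]
  note f' = linear_mapsD(1)[OF f] note g' = linear_mapsD(1)[OF g]
  have cl: "tensor_lift (tensor R M' N') (\<lambda>x y. pure_tensor R M' N' (f x) (g y)) s
      \<in> carrier (tensor_group R M' N')" if "s \<in> carrier (tensor_group R M N)" for s
    using A.tensor_lift_closed[OF T fg that] by (simp add: B.tensor_simps)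
  show ?thesis
    unfolding tensor_map_def using t
    by (induction t rule: A.tensor_induct)
       (simp_all add: A.tensor_lift_pure[OF T fg] A.tensor_lift_pure[OF P \<phi>fg]
         A.tensor_lift_add[OF T fg] A.tensor_lift_add[OF P \<phi>fg] f' g'
         B.tensor_lift_pure[OF P \<phi>] B.tensor_lift_add[OF P \<phi>] cl B.tensor_simps)
qed

locale algebra_pair = M: algebra R M + N: algebra R N
  for R :: "('k, 'r) ring_scheme"
    and M :: "('k, 'a, 'm) module_scheme"
    and N :: "('k, 'b, 'n) module_scheme"
begin

sublocale module_pair R M N
  by unfold_locales

lemma tensor_mult:
  "s \<otimes>\<^bsub>tensor R M N\<^esub> t = tensor_lift T (\<lambda>x y.
    tensor_lift T (\<lambda>x' y'. pure_tensor R M N (x \<otimes>\<^bsub>M\<^esub> x') (y \<otimes>\<^bsub>N\<^esub> y')) t) s"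
  by (simp add: tensor_def Let_def)

lemma smult_assoc2_right:
  "r \<in> carrier R \<Longrightarrow> x \<in> carrier M \<Longrightarrow> y \<in> carrier M \<Longrightarrow> x \<otimes>\<^bsub>M\<^esub> (r \<odot>\<^bsub>M\<^esub> y) = r \<odot>\<^bsub>M\<^esub> (x \<otimes>\<^bsub>M\<^esub> y)"
  "r \<in> carrier R \<Longrightarrow> x' \<in> carrier N \<Longrightarrow> y' \<in> carrier N \<Longrightarrow> x' \<otimes>\<^bsub>N\<^esub> (r \<odot>\<^bsub>N\<^esub> y') = r \<odot>\<^bsub>N\<^esub> (x' \<otimes>\<^bsub>N\<^esub> y')"
  by (simp_all add: M.m_comm[of x] N.m_comm[of x'] M.smult_assoc2 N.smult_assoc2)

lemma balanced_mult_pure: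
  assumes x: "x \<in> carrier M" and y: "y \<in> carrier N"
  shows "balanced_map R M N T (\<lambda>x' y'. pure_tensor R M N (x \<otimes>\<^bsub>M\<^esub> x') (y \<otimes>\<^bsub>N\<^esub> y'))"
  by (rule balanced_mapI)
     (use x y in \<open>simp_all add: balanced_mapD[OF balanced_pure_tensor] M.r_distr N.r_distr
        smult_assoc2_right\<close>)

text \<open>
  The outer of the two nested lifts in the definition of the product of \<open>M \<otimes> N\<close> is legitimate: by
  uniqueness, the inner lift depends on \<open>x\<close> and \<open>y\<close> in a balanced way.
\<close>

lemma balanced_mult:
  assumes t: "t \<in> carrier T"
  shows "balanced_map R M N T (\<lambda>x y.
    tensor_lift T (\<lambda>x' y'. pure_tensor R M N (x \<otimes>\<^bsub>M\<^esub> x') (y \<otimes>\<^bsub>N\<^esub> y')) t)"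
proof (rule balanced_mapI)
  note T = abelian_group_tensor_group
  note bal = balanced_mapD[OF balanced_pure_tensor]
  note bm = balanced_mult_pure
  let ?l = "\<lambda>x y. tensor_lift T (\<lambda>x' y'. pure_tensor R M N (x \<otimes>\<^bsub>M\<^esub> x') (y \<otimes>\<^bsub>N\<^esub> y')) t"
  show "?l x y \<in> carrier T" if "x \<in> carrier M" "y \<in> carrier N" for x y
    by (rule tensor_lift_closed[OF T bm[OF that] t])
  show "?l (x \<oplus>\<^bsub>M\<^esub> x') y = ?l x y \<oplus>\<^bsub>T\<^esub> ?l x' y"
    if "x \<in> carrier M" "x' \<in> carrier M" "y \<in> carrier N" for x x' y
    by (rule tensor_lift_sum[OF T bm bm bm _ t]) (use that in \<open>simp_all add: bal M.l_distr\<close>)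
  show "?l x (y \<oplus>\<^bsub>N\<^esub> y') = ?l x y \<oplus>\<^bsub>T\<^esub> ?l x y'"
    if "x \<in> carrier M" "y \<in> carrier N" "y' \<in> carrier N" for x y y'
    by (rule tensor_lift_sum[OF T bm bm bm _ t]) (use that in \<open>simp_all add: bal N.l_distr\<close>)
  show "?l (r \<odot>\<^bsub>M\<^esub> x) y = ?l x (r \<odot>\<^bsub>N\<^esub> y)"
    if "r \<in> carrier R" "x \<in> carrier M" "y \<in> carrier N" for r x y
    by (rule tensor_lift_cong[OF T bm bm _ t])
       (use that in \<open>simp_all add: bal M.smult_assoc2 N.smult_assoc2\<close>)
qed

text \<open>
  Both sides are additive in \<open>s\<close> and in \<open>t\<close>, so the hypothesis on products of pure tensors suffices.
\<close>

lemma tensor_lift_mult: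
  assumes C: "cring C" and \<phi>: "balanced_map R M N C \<phi>"
    and mult: "\<And>x y x' y'. \<lbrakk>x \<in> carrier M; y \<in> carrier N; x' \<in> carrier M; y' \<in> carrier N\<rbrakk>
      \<Longrightarrow> \<phi> (x \<otimes>\<^bsub>M\<^esub> x') (y \<otimes>\<^bsub>N\<^esub> y') = \<phi> x y \<otimes>\<^bsub>C\<^esub> \<phi> x' y'"
    and s: "s \<in> carrier T" and t: "t \<in> carrier T"
  shows "tensor_lift C \<phi> (s \<otimes>\<^bsub>tensor R M N\<^esub> t) = tensor_lift C \<phi> s \<otimes>\<^bsub>C\<^esub> tensor_lift C \<phi> t"
proof -
  interpret C: cring C by (rule C)
  note T = abelian_group_tensor_group
  note bm = balanced_mult[OF t]
  have C': "abelian_group C" by unfold_locales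
  note l = tensor_lift_closed[OF C' \<phi>] tensor_lift_add[OF C' \<phi>] tensor_lift_pure[OF C' \<phi>]
  have inner: "tensor_lift C \<phi> (tensor_lift T
      (\<lambda>x' y'. pure_tensor R M N (x \<otimes>\<^bsub>M\<^esub> x') (y \<otimes>\<^bsub>N\<^esub> y')) t) = \<phi> x y \<otimes>\<^bsub>C\<^esub> tensor_lift C \<phi> t"
    if xy: "x \<in> carrier M" "y \<in> carrier N" for x y
    using t
  proof (induction t rule: tensor_induct)
    case (pure x' y')
    then show ?case
      using xy by (simp add: tensor_lift_pure[OF T balanced_mult_pure[OF xy]] l mult)
  next
    case (add s t)
    then show ?case
      using tensor_lift_closed[OF T balanced_mult_pure[OF xy]] balanced_mapD(1)[OF \<phi> xy]
      by (simp add: tensor_lift_add[OF T balanced_mult_pure[OF xy]] l C.r_distr)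
  qed
  show ?thesis
    unfolding tensor_mult using s
  proof (induction s rule: tensor_induct)
    case (pure x y)
    then show ?case by (simp add: tensor_lift_pure[OF T bm] l inner)
  next
    case (add s s')
    then show ?case
      using tensor_lift_closed[OF T bm]
      by (simp add: tensor_lift_add[OF T bm] l t C.l_distr)
  qed
qed

end

lemma (in cring) module_self_module: "module R (self_module R)"
proof (rule moduleI)
  show "abelian_group (self_module R)"
    by (rule abelian_groupI) (auto simp: self_module_def a_ac intro: l_neg)
qed (auto simp: self_module_def is_cring m_assoc l_distr r_distr)

section \<open>Convolution powers in a commutative bialgebra\<close>

context commutative_bialgebra
begin

interpretation BB: algebra_pair R B B
  by unfold_locales

lemma module_self: "module R (self_module R)"
  by (rule R.module_self_module)

abbreviation "linear_endos \<equiv> linear_maps R B B"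
abbreviation convolve (infixl "\<star>" 70) where "f \<star> g \<equiv> convolution R B \<Delta> f g"
abbreviation "\<eta>\<epsilon> \<equiv> unit_map B \<circ> \<epsilon>"

lemma B_abelian: "abelian_group B"
  by unfold_locales

lemma balanced_mult_B: "balanced_map R B B B (\<lambda>x y. x \<otimes>\<^bsub>B\<^esub> y)"
  by (rule balanced_mapI) (simp_all add: l_distr r_distr smult_assoc2 BB.smult_assoc2_right)

lemmas balanced_conv = balanced_map_comp[OF balanced_mult_B]

lemma comult_closed: "b \<in> carrier B \<Longrightarrow> \<Delta> b \<in> carrier BB.T"
  using linear_mapsD(1)[OF comult_linear] by (simp add: BB.tensor_simps)

text \<open>
  In Sweedler notation: \<open>(f \<star> g)(b) = \<Sum> f(b\<^sub>1) g(b\<^sub>2)\<close>. All later statements about convolution are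
  derived from this form.
\<close>

lemma convolution_eq:
  assumes "f \<in> linear_endos" "g \<in> linear_endos" "b \<in> carrier B"
  shows "(f \<star> g) b = tensor_lift B (\<lambda>x y. f x \<otimes>\<^bsub>B\<^esub> g y) (\<Delta> b)"
  unfolding convolution_def mult_map_def comp_def
  by (rule tensor_lift_tensor_map[OF BB.module_pair_axioms BB.module_pair_axioms assms(1,2) B_abelian
        balanced_mult_B comult_closed[OF assms(3)]])

lemma convolution_linear:
  assumes f: "f \<in> linear_endos" and g: "g \<in> linear_endos"
  shows "f \<star> g \<in> linear_endos"
proof (rule linear_mapsI)
  note bc = balanced_conv[OF f g]
  note \<Delta> = linear_mapsD[OF comult_linear, unfolded BB.tensor_simps]
  show "(f \<star> g) x \<in> carrier B" if "x \<in> carrier B" for x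
    using that by (simp add: convolution_eq[OF f g] comult_closed BB.tensor_lift_closed[OF B_abelian bc])
  show "(f \<star> g) (x \<oplus>\<^bsub>B\<^esub> y) = (f \<star> g) x \<oplus>\<^bsub>B\<^esub> (f \<star> g) y" if "x \<in> carrier B" "y \<in> carrier B" for x y
    using that
    by (simp add: convolution_eq[OF f g] comult_closed \<Delta> BB.tensor_lift_add[OF B_abelian bc])
  show "(f \<star> g) (r \<odot>\<^bsub>B\<^esub> x) = r \<odot>\<^bsub>B\<^esub> (f \<star> g) x" if "r \<in> carrier R" "x \<in> carrier B" for r x
    using that
    by (simp add: convolution_eq[OF f g] comult_closed \<Delta>)
       (rule BB.tensor_lift_smult[OF module bc],
        simp_all add: comult_closed linear_mapsD[OF f] linear_mapsD[OF g] smult_assoc2)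
qed

lemma linear_diff:
  assumes f: "f \<in> linear_endos" and g: "g \<in> linear_endos"
  shows "(\<lambda>x. f x \<ominus>\<^bsub>B\<^esub> g x) \<in> linear_endos"
proof (rule linear_mapsI)
  note fg = linear_mapsD[OF f] linear_mapsD[OF g]
  show "f (x \<oplus>\<^bsub>B\<^esub> y) \<ominus>\<^bsub>B\<^esub> g (x \<oplus>\<^bsub>B\<^esub> y) = f x \<ominus>\<^bsub>B\<^esub> g x \<oplus>\<^bsub>B\<^esub> (f y \<ominus>\<^bsub>B\<^esub> g y)"
    if "x \<in> carrier B" "y \<in> carrier B" for x y
    using that by (simp add: fg minus_eq minus_add a_ac)
  show "f (r \<odot>\<^bsub>B\<^esub> x) \<ominus>\<^bsub>B\<^esub> g (r \<odot>\<^bsub>B\<^esub> x) = r \<odot>\<^bsub>B\<^esub> (f x \<ominus>\<^bsub>B\<^esub> g x)"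
    if "r \<in> carrier R" "x \<in> carrier B" for r x
    using that by (simp add: fg minus_eq smult_r_distr smult_r_minus)
qed (simp add: linear_mapsD[OF f] linear_mapsD[OF g])

lemma convolution_diff_left:
  assumes f: "f \<in> linear_endos" and f': "f' \<in> linear_endos" and g: "g \<in> linear_endos"
    and b: "b \<in> carrier B"
  shows "((\<lambda>x. f x \<ominus>\<^bsub>B\<^esub> f' x) \<star> g) b = (f \<star> g) b \<ominus>\<^bsub>B\<^esub> (f' \<star> g) b"
proof -
  note ff' = linear_diff[OF f f']
  show ?thesis
    unfolding convolution_eq[OF f g b] convolution_eq[OF f' g b] convolution_eq[OF ff' g b]
  proof (rule BB.tensor_lift_diff[OF B_abelian balanced_conv[OF f g] balanced_conv[OF f' g]
        balanced_conv[OF ff' g] _ comult_closed[OF b]])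
    fix x y assume "x \<in> carrier B" "y \<in> carrier B"
    then have "f x \<in> carrier B" "f' x \<in> carrier B" "g y \<in> carrier B"
      using f f' g by (auto intro: linear_mapsD(1))
    then show "(f x \<ominus>\<^bsub>B\<^esub> f' x) \<otimes>\<^bsub>B\<^esub> g y = f x \<otimes>\<^bsub>B\<^esub> g y \<ominus>\<^bsub>B\<^esub> f' x \<otimes>\<^bsub>B\<^esub> g y"
      by (simp add: minus_eq l_distr l_minus)
  qed
qed

lemma convolution_diff_right:
  assumes f: "f \<in> linear_endos" and g: "g \<in> linear_endos" and g': "g' \<in> linear_endos"
    and b: "b \<in> carrier B"
  shows "(f \<star> (\<lambda>x. g x \<ominus>\<^bsub>B\<^esub> g' x)) b = (f \<star> g) b \<ominus>\<^bsub>B\<^esub> (f \<star> g') b"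
proof -
  note gg' = linear_diff[OF g g']
  show ?thesis
    unfolding convolution_eq[OF f g b] convolution_eq[OF f g' b] convolution_eq[OF f gg' b]
  proof (rule BB.tensor_lift_diff[OF B_abelian balanced_conv[OF f g] balanced_conv[OF f g']
        balanced_conv[OF f gg'] _ comult_closed[OF b]])
    fix x y assume "x \<in> carrier B" "y \<in> carrier B"
    then have "f x \<in> carrier B" "g y \<in> carrier B" "g' y \<in> carrier B"
      using f g g' by (auto intro: linear_mapsD(1))
    then show "f x \<otimes>\<^bsub>B\<^esub> (g y \<ominus>\<^bsub>B\<^esub> g' y) = f x \<otimes>\<^bsub>B\<^esub> g y \<ominus>\<^bsub>B\<^esub> f x \<otimes>\<^bsub>B\<^esub> g' y"
      by (simp add: minus_eq r_distr r_minus)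
  qed
qed

lemma convolution_cong:
  assumes "f \<in> linear_endos" "f' \<in> linear_endos" "g \<in> linear_endos" "g' \<in> linear_endos"
    and eq: "\<And>x. x \<in> carrier B \<Longrightarrow> f x = f' x" "\<And>x. x \<in> carrier B \<Longrightarrow> g x = g' x"
    and b: "b \<in> carrier B"
  shows "(f \<star> g) b = (f' \<star> g') b"
  unfolding convolution_eq[OF assms(1,3) b] convolution_eq[OF assms(2,4) b]
  by (rule BB.tensor_lift_cong[OF B_abelian balanced_conv balanced_conv])
     (simp_all add: assms comult_closed)

lemma unit_map_linear: "unit_map B \<in> linear_maps R (self_module R) B"
  by (rule linear_mapsI)
     (simp_all add: unit_map_def self_module_def smult_l_distr smult_assoc1)

lemma linear_comp:
  "g \<in> linear_maps R M' N' \<Longrightarrow> f \<in> linear_maps R L' M' \<Longrightarrow> g \<circ> f \<in> linear_maps R L' N'"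
  by (rule linear_mapsI) (simp_all add: linear_mapsD[of f R L' M'] linear_mapsD[of g R M' N'])

lemma unit_counit_linear: "\<eta>\<epsilon> \<in> linear_endos"
  by (rule linear_comp[OF unit_map_linear counit_linear])

lemma id_linear: "(\<lambda>x. x) \<in> linear_maps R M' M'"
  by (rule linear_mapsI) auto

text \<open>
  The summands \<open>\<epsilon>(b\<^sub>1) f(b\<^sub>2)\<close> factor through \<open>\<epsilon> \<otimes> id\<close>, to which the counit axiom applies.
\<close>

lemma convolution_unit_left:
  assumes f: "f \<in> linear_endos" and b: "b \<in> carrier B"
  shows "(\<eta>\<epsilon> \<star> f) b = f b"
proof -
  interpret RB: module_pair R "self_module R" B
    using module_self module by (simp add: module_pair_def)
  note bal = balanced_map_comp[OF balanced_mult_B unit_map_linear f]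
  have 1: "\<one>\<^bsub>R\<^esub> \<in> carrier (self_module R)" by (simp add: self_module_def)
  have "(\<eta>\<epsilon> \<star> f) b = tensor_lift B (\<lambda>r y. unit_map B r \<otimes>\<^bsub>B\<^esub> f y)
      (tensor_map R (self_module R) B \<epsilon> (\<lambda>x. x) (\<Delta> b))"
    unfolding convolution_eq[OF unit_counit_linear f b] unfolding comp_def
    by (rule tensor_lift_tensor_map[OF BB.module_pair_axioms RB.module_pair_axioms counit_linear
          id_linear B_abelian bal comult_closed[OF b], symmetric])
  also have "\<dots> = unit_map B \<one>\<^bsub>R\<^esub> \<otimes>\<^bsub>B\<^esub> f b"
    unfolding counit_left[OF b] by (rule RB.tensor_lift_pure[OF B_abelian bal 1 b])
  also have "\<dots> = f b" using linear_mapsD(1)[OF f b] by (simp add: unit_map_def)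
  finally show ?thesis .
qed

lemma convolution_unit_right:
  assumes f: "f \<in> linear_endos" and b: "b \<in> carrier B"
  shows "(f \<star> \<eta>\<epsilon>) b = f b"
proof -
  interpret BR: module_pair R B "self_module R"
    using module_self module by (simp add: module_pair_def)
  note bal = balanced_map_comp[OF balanced_mult_B f unit_map_linear]
  have 1: "\<one>\<^bsub>R\<^esub> \<in> carrier (self_module R)" by (simp add: self_module_def)
  have "(f \<star> \<eta>\<epsilon>) b = tensor_lift B (\<lambda>x r. f x \<otimes>\<^bsub>B\<^esub> unit_map B r)
      (tensor_map R B (self_module R) (\<lambda>x. x) \<epsilon> (\<Delta> b))"
    unfolding convolution_eq[OF f unit_counit_linear b] unfolding comp_def
    by (rule tensor_lift_tensor_map[OF BB.module_pair_axioms BR.module_pair_axioms id_linear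
          counit_linear B_abelian bal comult_closed[OF b], symmetric])
  also have "\<dots> = f b \<otimes>\<^bsub>B\<^esub> unit_map B \<one>\<^bsub>R\<^esub>"
    unfolding counit_right[OF b] by (rule BR.tensor_lift_pure[OF B_abelian bal b 1])
  also have "\<dots> = f b" using linear_mapsD(1)[OF f b] by (simp add: unit_map_def)
  finally show ?thesis .
qed

text \<open>
  This is where commutativity enters: \<open>f \<star> g\<close> is the composite of \<open>\<Delta>\<close> with \<open>x \<otimes> y \<mapsto> f(x) g(y)\<close>, and
  the latter is multiplicative because values of \<open>f\<close> and \<open>g\<close> commute.
\<close>

lemma convolution_ring_hom:
  assumes f: "f \<in> linear_endos" "f \<in> ring_hom B B" and g: "g \<in> linear_endos" "g \<in> ring_hom B B"
  shows "f \<star> g \<in> ring_hom B B"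
proof (rule ring_hom_memI)
  note lin = linear_mapsD[OF convolution_linear[OF f(1) g(1)]]
  note bc = balanced_conv[OF f(1) g(1)]
  show "(f \<star> g) x \<in> carrier B" if "x \<in> carrier B" for x using lin(1)[OF that] .
  show "(f \<star> g) (x \<oplus>\<^bsub>B\<^esub> y) = (f \<star> g) x \<oplus>\<^bsub>B\<^esub> (f \<star> g) y" if "x \<in> carrier B" "y \<in> carrier B" for x y
    using lin(2)[OF that] .
  show "(f \<star> g) \<one>\<^bsub>B\<^esub> = \<one>\<^bsub>B\<^esub>"
  proof -
    have "\<Delta> \<one>\<^bsub>B\<^esub> = pure_tensor R B B \<one>\<^bsub>B\<^esub> \<one>\<^bsub>B\<^esub>"
      using ring_hom_one[OF comult_hom] by (simp add: tensor_def Let_def)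
    then show ?thesis
      by (simp add: convolution_eq f g BB.tensor_lift_pure[OF B_abelian bc] ring_hom_one[OF f(2)]
          ring_hom_one[OF g(2)])
  qed
  show "(f \<star> g) (x \<otimes>\<^bsub>B\<^esub> y) = (f \<star> g) x \<otimes>\<^bsub>B\<^esub> (f \<star> g) y" if x: "x \<in> carrier B" and y: "y \<in> carrier B" for x y
  proof -
    have "(f \<star> g) (x \<otimes>\<^bsub>B\<^esub> y) = tensor_lift B (\<lambda>x y. f x \<otimes>\<^bsub>B\<^esub> g y) (\<Delta> x \<otimes>\<^bsub>tensor R B B\<^esub> \<Delta> y)"
      using x y by (simp add: convolution_eq f g ring_hom_mult[OF comult_hom])
    also have "\<dots> = tensor_lift B (\<lambda>x y. f x \<otimes>\<^bsub>B\<^esub> g y) (\<Delta> x) \<otimes>\<^bsub>B\<^esub> tensor_lift B (\<lambda>x y. f x \<otimes>\<^bsub>B\<^esub> g y) (\<Delta> y)"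
    proof (rule BB.tensor_lift_mult[OF M_cring bc _ comult_closed[OF x] comult_closed[OF y]])
      fix x y x' y'
      assume *: "x \<in> carrier B" "y \<in> carrier B" "x' \<in> carrier B" "y' \<in> carrier B"
      show "f (x \<otimes>\<^bsub>B\<^esub> x') \<otimes>\<^bsub>B\<^esub> g (y \<otimes>\<^bsub>B\<^esub> y') = f x \<otimes>\<^bsub>B\<^esub> g y \<otimes>\<^bsub>B\<^esub> (f x' \<otimes>\<^bsub>B\<^esub> g y')"
        using * linear_mapsD(1)[OF f(1)] linear_mapsD(1)[OF g(1)]
        by (simp add: ring_hom_mult[OF f(2)] ring_hom_mult[OF g(2)] m_ac)
    qed
    finally show ?thesis using x y by (simp add: convolution_eq f g)
  qed
qed

lemma unit_counit_ring_hom: "\<eta>\<epsilon> \<in> ring_hom B B"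
proof (rule ring_hom_memI)
  note e = ring_hom_mult[OF counit_hom] ring_hom_add[OF counit_hom] ring_hom_one[OF counit_hom]
    ring_hom_closed[OF counit_hom]
  show "\<eta>\<epsilon> (x \<otimes>\<^bsub>B\<^esub> y) = \<eta>\<epsilon> x \<otimes>\<^bsub>B\<^esub> \<eta>\<epsilon> y" if "x \<in> carrier B" "y \<in> carrier B" for x y
    using that by (simp add: unit_map_def e smult_assoc1 smult_assoc2)
qed (simp_all add: unit_map_def ring_hom_add[OF counit_hom] ring_hom_one[OF counit_hom]
    ring_hom_closed[OF counit_hom] smult_l_distr)

lemma conv_power_linear: "f \<in> linear_endos \<Longrightarrow> conv_power R B \<Delta> \<epsilon> f k \<in> linear_endos"
  by (induction k) (simp_all add: unit_counit_linear convolution_linear)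

abbreviation "id_power \<equiv> conv_power R B \<Delta> \<epsilon> (\<lambda>x. x)"
abbreviation "\<delta> \<equiv> (\<lambda>x. unit_map B (\<epsilon> x) \<ominus>\<^bsub>B\<^esub> x)"
abbreviation "\<delta>_power \<equiv> conv_power R B \<Delta> \<epsilon> \<delta>"

lemma id_ring_hom: "(\<lambda>x. x) \<in> ring_hom B B"
  by (rule ring_hom_memI) auto

lemma id_power_ring_hom: "id_power k \<in> ring_hom B B"
proof (induction k)
  case 0
  show ?case unfolding conv_power.simps by (rule unit_counit_ring_hom)
next
  case (Suc k)
  then show ?case
    by (simp add: convolution_ring_hom id_linear conv_power_linear id_ring_hom)
qed

lemma id_power_grouplike:
  assumes "grouplike R B \<Delta> \<epsilon> g"
  shows "id_power k g = g [^]\<^bsub>B\<^esub> k"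
proof (induction k)
  have g: "g \<in> carrier B" "\<Delta> g = pure_tensor R B B g g" "\<epsilon> g = \<one>\<^bsub>R\<^esub>"
    using assms by (auto simp: grouplike_def)
  {
    case 0
    then show ?case using g by (simp add: unit_map_def)
  next
    case (Suc k)
    note lin = id_linear conv_power_linear[OF id_linear, of k]
    have "id_power (Suc k) g = g \<otimes>\<^bsub>B\<^esub> id_power k g"
      using BB.tensor_lift_pure[OF B_abelian balanced_conv[OF lin] g(1) g(1)]
      by (simp add: convolution_eq lin g)
    then show ?case using Suc g(1) m_comm by simp
  }
qed

lemma \<delta>_linear: "\<delta> \<in> linear_endos"
  using linear_diff[OF unit_counit_linear id_linear] by simp

lemma bdiff_\<delta>_power_linear: "(\<lambda>b. (bdiff B ^^ k) (\<lambda>j. \<delta>_power j b) i) \<in> linear_endos"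
proof (induction k arbitrary: i)
  case (Suc k)
  show ?case using linear_diff[OF Suc Suc] by (simp add: bdiff_def[of B "(bdiff B ^^ k) _"])
qed (simp add: conv_power_linear[OF \<delta>_linear])

text \<open>
  Convolving with \<open>\<delta>\<close> shifts \<open>j \<mapsto> \<delta>\<^sup>j\<close> by one place, and bilinearity carries this shift through the
  differences.
\<close>

lemma \<delta>_convolve_bdiff:
  assumes "b \<in> carrier B"
  shows "(\<delta> \<star> (\<lambda>b. (bdiff B ^^ k) (\<lambda>j. \<delta>_power j b) i)) b = (bdiff B ^^ k) (\<lambda>j. \<delta>_power j b) (Suc i)"
  using assms
proof (induction k arbitrary: i)
  case (Suc k)
  note l = bdiff_\<delta>_power_linear[of k]
  show ?case
    using convolution_diff_right[OF \<delta>_linear l l Suc.prems] Suc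
    by (simp add: bdiff_def[of B "(bdiff B ^^ k) _"])
qed simp

text \<open>
  The binomial expansion of \<open>(\<eta>\<epsilon> - \<delta>)\<^sup>k\<close>. For the induction step, \<open>id = \<eta>\<epsilon> - \<delta>\<close>; convolving the
  \<open>k\<close>-th difference at \<open>0\<close> with \<open>\<eta>\<epsilon>\<close> leaves it unchanged and convolving it with \<open>\<delta>\<close> moves it to \<open>1\<close>,
  so the result is the next difference at \<open>0\<close>.
\<close>

lemma id_power_eq_bdiff:
  assumes "b \<in> carrier B"
  shows "id_power k b = (bdiff B ^^ k) (\<lambda>j. \<delta>_power j b) 0"
  using assms
proof (induction k arbitrary: b)
  case (Suc k)
  let ?d = "\<lambda>i b. (bdiff B ^^ k) (\<lambda>j. \<delta>_power j b) i"
  note lin = conv_power_linear[OF id_linear, of k] bdiff_\<delta>_power_linear[of k]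
  have "id_power (Suc k) b = ((\<lambda>x. \<eta>\<epsilon> x \<ominus>\<^bsub>B\<^esub> \<delta> x) \<star> ?d 0) b"
    unfolding conv_power.simps
  proof (rule convolution_cong)
    fix x assume x: "x \<in> carrier B"
    have "\<eta>\<epsilon> x \<in> carrier B" by (rule linear_mapsD(1)[OF unit_counit_linear x])
    moreover have "y \<ominus>\<^bsub>B\<^esub> (y \<ominus>\<^bsub>B\<^esub> x) = x" if "y \<in> carrier B" for y
      using x that by algebra
    ultimately show "x = \<eta>\<epsilon> x \<ominus>\<^bsub>B\<^esub> \<delta> x" by simp
  qed (use lin Suc id_linear linear_diff[OF unit_counit_linear \<delta>_linear] in auto)
  also have "\<dots> = (\<eta>\<epsilon> \<star> ?d 0) b \<ominus>\<^bsub>B\<^esub> (\<delta> \<star> ?d 0) b"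
    by (rule convolution_diff_left[OF unit_counit_linear \<delta>_linear lin(2) Suc.prems])
  also have "\<dots> = ?d 0 b \<ominus>\<^bsub>B\<^esub> ?d 1 b"
    using convolution_unit_left[OF lin(2) Suc.prems] \<delta>_convolve_bdiff[OF Suc.prems] by simp
  finally show ?case by (simp add: bdiff_def[of B "(bdiff B ^^ k) _"])
qed simp

lemma id_power_1: "b \<in> carrier B \<Longrightarrow> id_power 1 b = b"
  by (simp add: convolution_unit_right id_linear)

text \<open>
  The function \<open>k \<mapsto> id\<^sup>k(b)\<close> is polynomial: by duality its \<open>d\<close>-th difference at \<open>k\<close> is the \<open>k\<close>-th
  difference of \<open>j \<mapsto> \<delta>\<^sup>j(b)\<close> at \<open>d\<close>, and from some place on that sequence is zero.
\<close>

lemma id_unipotent_bdiff_nilpotent: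
  assumes "id_unipotent R B \<Delta> \<epsilon> b"
  shows "\<exists>d. \<forall>k. (bdiff B ^^ d) (\<lambda>k. id_power k b) k = \<zero>\<^bsub>B\<^esub>"
proof -
  obtain m where b: "b \<in> carrier B" and m: "\<And>n. int n > m \<Longrightarrow> \<delta>_power n b = \<zero>\<^bsub>B\<^esub>"
    using assms unfolding id_unipotent_def by blast
  have "\<delta>_power j b = \<zero>\<^bsub>B\<^esub>" if "nat (m + 1) \<le> j" for j by (rule m) (use that in linarith)
  then have "(bdiff B ^^ k) (\<lambda>j. \<delta>_power j b) (nat (m + 1)) = \<zero>\<^bsub>B\<^esub>" for k
    by (rule bdiff_pow_eventually_zero[OF _ order_refl])
  moreover have "(bdiff B ^^ j) (\<lambda>k. id_power k b) k = (bdiff B ^^ k) (\<lambda>j. \<delta>_power j b) j" for j k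
    unfolding id_power_eq_bdiff[OF b]
    by (rule bdiff_duality) (rule linear_mapsD(1)[OF conv_power_linear[OF \<delta>_linear] b])
  ultimately show ?thesis by auto
qed

end

section \<open>Independence of grouplike elements\<close>

theorem theorem4p7:
  fixes R :: "('k, 'r) ring_scheme"
    and B :: "('k, 'b, 'm) module_scheme"
    and \<Delta> :: "'b \<Rightarrow> (('b \<times> 'b) \<Rightarrow>\<^sub>0 int) set"
    and \<epsilon> :: "'b \<Rightarrow> 'k"
    and n :: nat
    and g :: "nat \<Rightarrow> 'b"
  assumes "commutative_bialgebra R B \<Delta> \<epsilon>"
    and "\<And>i. 1 \<le> i \<Longrightarrow> i \<le> n \<Longrightarrow> grouplike R B \<Delta> \<epsilon> (g i)"
    and "\<And>i j. 1 \<le> i \<Longrightarrow> i < j \<Longrightarrow> j \<le> n \<Longrightarrow> regular_element B (g i \<ominus>\<^bsub>B\<^esub> g j)"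
    and "\<And>i. 1 \<le> i \<Longrightarrow> i \<le> n \<Longrightarrow> regular_element B (g i)"
  shows "lin_independent_over B {b. id_unipotent R B \<Delta> \<epsilon> b} n g"
  unfolding lin_independent_over_def
proof (intro ballI impI)
  interpret commutative_bialgebra R B \<Delta> \<epsilon> by fact
  fix s i
  assume s: "s \<in> {1..n} \<rightarrow> {b. id_unipotent R B \<Delta> \<epsilon> b}"
    and sum: "(\<Oplus>\<^bsub>B\<^esub>i\<in>{1..n}. s i \<otimes>\<^bsub>B\<^esub> g i) = \<zero>\<^bsub>B\<^esub>" and i: "i \<in> {1..n}"
  have g: "g j \<in> carrier B" if "j \<in> {1..n}" for j
    using assms(2)[of j] that by (simp add: grouplike_def)
  have su: "id_unipotent R B \<Delta> \<epsilon> (s j)" if "j \<in> {1..n}" for j using s that by blast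
  then have sc: "s j \<in> carrier B" if "j \<in> {1..n}" for j using that by (simp add: id_unipotent_def)
  have "id_power 1 (s i) = \<zero>\<^bsub>B\<^esub>"
  proof (rule exponential_polynomials_independent[where I = "{1..n}" and g = g
        and p = "\<lambda>i k. id_power k (s i)"])
    show "regular_element B (g j \<ominus>\<^bsub>B\<^esub> g l)" if "j \<in> {1..n}" "l \<in> {1..n}" "j \<noteq> l" for j l
    proof (cases "j < l")
      case True
      then show ?thesis using assms(3) that by simp
    next
      case False
      then have "regular_element B (g l \<ominus>\<^bsub>B\<^esub> g j)" using assms(3)[of l j] that by simp
      then show ?thesis by (rule regular_diff_commute[OF _ g[OF that(2)] g[OF that(1)]])
    qed
    show "(\<Oplus>\<^bsub>B\<^esub>j\<in>{1..n}. id_power k (s j) \<otimes>\<^bsub>B\<^esub> g j [^]\<^bsub>B\<^esub> k) = \<zero>\<^bsub>B\<^esub>" for k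
    proof -
      interpret h: ring_hom_cring B B "id_power k"
        using id_power_ring_hom by unfold_locales
      have "(\<Oplus>\<^bsub>B\<^esub>j\<in>{1..n}. id_power k (s j) \<otimes>\<^bsub>B\<^esub> g j [^]\<^bsub>B\<^esub> k)
          = (\<Oplus>\<^bsub>B\<^esub>j\<in>{1..n}. id_power k (s j \<otimes>\<^bsub>B\<^esub> g j))"
      proof (rule finsum_cong')
        fix j assume j: "j \<in> {1..n}"
        have "id_power k (g j) = g j [^]\<^bsub>B\<^esub> k"
          by (rule id_power_grouplike) (use assms(2) j in simp)
        then show "id_power k (s j) \<otimes>\<^bsub>B\<^esub> g j [^]\<^bsub>B\<^esub> k = id_power k (s j \<otimes>\<^bsub>B\<^esub> g j)"
          using sc[OF j] g[OF j] by simp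
      qed (use sc g in auto)
      also have "\<dots> = id_power k (\<Oplus>\<^bsub>B\<^esub>j\<in>{1..n}. s j \<otimes>\<^bsub>B\<^esub> g j)"
        using h.hom_finsum[of "\<lambda>j. s j \<otimes>\<^bsub>B\<^esub> g j" "{1..n}"] sc g by (simp add: comp_def)
      finally show ?thesis by (simp only: sum h.hom_zero)
    qed
    show "regular_element B (g j)" if "j \<in> {1..n}" for j using assms(4) that by simp
    show "id_power k (s j) \<in> carrier B" if "j \<in> {1..n}" for j k
      by (rule linear_mapsD(1)[OF conv_power_linear[OF id_linear] sc[OF that]])
    show "\<exists>d. \<forall>k. (bdiff B ^^ d) (\<lambda>k. id_power k (s j)) k = \<zero>\<^bsub>B\<^esub>" if "j \<in> {1..n}" for j
      by (rule id_unipotent_bdiff_nilpotent[OF su[OF that]])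
  qed (use i in auto)
  then show "s i = \<zero>\<^bsub>B\<^esub>" using id_power_1[OF sc[OF i]] by simp
qed

end
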